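(* For any $m\in\mathbb{N}$, any $\boldsymbol{b}\in\mathbb{R}^m$, and any $n\in\mathbb{N}$, the set $\{\boldsymbol{x}\,\sharp\,\boldsymbol{b}:\boldsymbol{x}\in\mathbb{R}^n\}\subseteq\mathbb{R}^{n+m}$ is gap-rich.
   Context: $\mathbb{N}=\{1,2,\ldots\}$. For $\boldsymbol{x}=(x_1,\ldots,x_n)\in\mathbb{R}^n$ and $\boldsymbol{b}=(b_1,\ldots,b_m)\in\mathbb{R}^m$, $\boldsymbol{x}\,\sharp\,\boldsymbol{b}=(x_1,\ldots,x_n,b_1,\ldots,b_m)\in\mathbb{R}^{n+m}$ is the concatenation. Let $k\in\mathbb{N}$ and let $Y\subseteq\mathbb{R}^k$ be closed without isolated points, with the metric $d$ induced by a norm on $\mathbb{R}^k$. Words over $Y$: $Y^\star=\bigcup_{p\ge1}Y^p$. For $\boldsymbol{x}\in Y^p$, $\boldsymbol{x}^{\sharp\mathbb{Z}}\in Y^{\mathbb{Z}}$ is the $p$-periodic sequence coinciding with $\boldsymbol{x}$ on $\{1,\ldots,p\}$. For words $\boldsymbol{x},\boldsymbol{y}\in Y^\star$ of possibly different lengths, $d(\boldsymbol{x},\boldsymbol{y}):=\sup_{j\in\mathbb{Z}}d\big((\boldsymbol{x}^{\sharp\mathbb{Z}})_j,(\boldsymbol{y}^{\sharp\mathbb{Z}})_j\big)$. For bounded $\boldsymbol{y}=(y_j)_{j\in\mathbb{Z}}\in(\mathbb{R}^k)^{\mathbb{Z}}$ with $y_j=(y_j(1),\ldots,y_j(k))$,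 define $\boldsymbol{y}^\natural:\mathbb{Z}\to\mathbb{R}$ by $\boldsymbol{y}^\natural(jk+\ell)=y_j(\ell)$, $j\in\mathbb{Z}$, $1\le\ell\le k$, and let $H_{\boldsymbol{y}}$ act on $\ell^2(\mathbb{Z})$ by $[H_{\boldsymbol{y}}\psi](n)=\psi(n-1)+\psi(n+1)+\boldsymbol{y}^\natural(n)\psi(n)$. For a word $\boldsymbol{x}\in Y^p$, $H_{\boldsymbol{x}}:=H_{\boldsymbol{x}^{\sharp\mathbb{Z}}}$. $\operatorname{spec}$ denotes the spectrum. $Y$ is gap-rich with exceptional set $S\subseteq\mathbb{R}$ if $S$ is discrete and for every $E\in\mathbb{R}\setminus S$, $\boldsymbol{x}\in Y^\star$ and $\varepsilon>0$ there exists $\boldsymbol{y}\in Y^\star$ with $d(\boldsymbol{x},\boldsymbol{y})<\varepsilon$ and $E\notin\operatorname{spec}(H_{\boldsymbol{y}})$. $Y$ is gap-rich if it is gap-rich with some exceptional set. *)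

theory Defs
  imports "HOL-Analysis.Analysis"
begin

text \<open>
  \<open>\<real>\<^sup>k\<close> is the library's \<^const>\<open>Euclidean_space\<close>: functions \<open>nat \<Rightarrow> real\<close> vanishing at all
  indices \<open>\<ge> k\<close>.  The coordinate \<open>x\<^sub>\<ell>\<close>, \<open>1 \<le> \<ell> \<le> k\<close>, of the usual numbering is \<open>x (\<ell> - 1)\<close>.
\<close>

abbreviation Rvec :: "nat \<Rightarrow> (nat \<Rightarrow> real) set" where
  "Rvec k \<equiv> topspace (Euclidean_space k)"

definition vconcat :: "nat \<Rightarrow> (nat \<Rightarrow> real) \<Rightarrow> (nat \<Rightarrow> real) \<Rightarrow> (nat \<Rightarrow> real)" where
  "vconcat n x b = (\<lambda>i. if i < n then x i else b (i - n))"

definition norm_on_Rvec :: "nat \<Rightarrow> ((nat \<Rightarrow> real) \<Rightarrow> real) \<Rightarrow> bool" where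
  "norm_on_Rvec k N \<longleftrightarrow>
     (\<forall>x\<in>Rvec k. N x \<ge> 0) \<and>
     (\<forall>x\<in>Rvec k. N x = 0 \<longleftrightarrow> x = (\<lambda>i. 0)) \<and>
     (\<forall>x\<in>Rvec k. \<forall>c. N (\<lambda>i. c * x i) = \<bar>c\<bar> * N x) \<and>
     (\<forall>x\<in>Rvec k. \<forall>y\<in>Rvec k. N (\<lambda>i. x i + y i) \<le> N x + N y)"

definition closed_no_isolated :: "nat \<Rightarrow> (nat \<Rightarrow> real) set \<Rightarrow> bool" where
  "closed_no_isolated k Y \<longleftrightarrow>
     closedin (Euclidean_space k) Y \<and> Y \<subseteq> Euclidean_space k derived_set_of Y"


definition nonempty_words :: "'a set \<Rightarrow> 'a list set" where
  "nonempty_words Y = {xs. xs \<noteq> [] \<and> set xs \<subseteq> Y}"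

text \<open>
  The periodic extension of a word of length \<open>p\<close> agrees with the word on \<open>{1, \<dots>, p}\<close>, while lists
  are indexed from 0; hence the shift by one.
\<close>

definition periodic_ext :: "'a list \<Rightarrow> int \<Rightarrow> 'a" where
  "periodic_ext xs j = xs ! nat ((j - 1) mod int (length xs))"

definition word_dist ::
  "((nat \<Rightarrow> real) \<Rightarrow> real) \<Rightarrow> (nat \<Rightarrow> real) list \<Rightarrow> (nat \<Rightarrow> real) list \<Rightarrow> real" where
  "word_dist N xs ys = (SUP j::int. N (\<lambda>i. periodic_ext xs j i - periodic_ext ys j i))"


definition l2 :: "(int \<Rightarrow> complex) set" where
  "l2 = {\<psi>. (\<lambda>n. (norm (\<psi> n))\<^sup>2) summable_on UNIV}"

definition l2_norm :: "(int \<Rightarrow> complex) \<Rightarrow> real" where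
  "l2_norm \<psi> = sqrt (\<Sum>\<^sub>\<infinity>n. (norm (\<psi> n))\<^sup>2)"

text \<open>
  The operator \<open>T - z\<close> is boundedly invertible on \<open>\<ell>\<^sup>2(\<int>)\<close> iff it is a bijection of \<open>\<ell>\<^sup>2(\<int>)\<close> onto
  itself whose inverse is bounded; the bound on the inverse is stated for vectors of the form
  \<open>(T - z) \<psi>\<close>.
\<close>

definition l2_spectrum :: "((int \<Rightarrow> complex) \<Rightarrow> (int \<Rightarrow> complex)) \<Rightarrow> complex set" where
  "l2_spectrum T = {z. \<not> (bij_betw (\<lambda>\<psi> n. T \<psi> n - z * \<psi> n) l2 l2 \<and>
                          (\<exists>C. \<forall>\<psi>\<in>l2. l2_norm \<psi> \<le> C * l2_norm (\<lambda>n. T \<psi> n - z * \<psi> n)))}"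

text \<open>
  \<open>y\<^sup>\<natural>(j k + \<ell>) = y\<^sub>j(\<ell>)\<close> for \<open>1 \<le> \<ell> \<le> k\<close>: with \<open>n = j k + \<ell>\<close> one has \<open>j = (n - 1) div k\<close> and
  \<open>\<ell> - 1 = (n - 1) mod k\<close>.
\<close>

definition flatten :: "nat \<Rightarrow> (int \<Rightarrow> nat \<Rightarrow> real) \<Rightarrow> int \<Rightarrow> real" where
  "flatten k y n = y ((n - 1) div int k) (nat ((n - 1) mod int k))"

definition schroedinger ::
  "nat \<Rightarrow> (int \<Rightarrow> nat \<Rightarrow> real) \<Rightarrow> (int \<Rightarrow> complex) \<Rightarrow> (int \<Rightarrow> complex)" where
  "schroedinger k y \<psi> = (\<lambda>n. \<psi> (n - 1) + \<psi> (n + 1) + complex_of_real (flatten k y n) * \<psi> n)"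


text \<open>
  Being gap-rich is only defined for closed sets \<open>Y \<subseteq> \<real>\<^sup>k\<close> without isolated points, so this
  requirement is part of the definition.  The parameter \<open>N\<close> is the norm on \<open>\<real>\<^sup>k\<close> inducing the metric.
\<close>

definition gap_rich_with ::
  "nat \<Rightarrow> ((nat \<Rightarrow> real) \<Rightarrow> real) \<Rightarrow> (nat \<Rightarrow> real) set \<Rightarrow> real set \<Rightarrow> bool" where
  "gap_rich_with k N Y S \<longleftrightarrow>
     closed_no_isolated k Y \<and>
     discrete S \<and>
     (\<forall>E. E \<notin> S \<longrightarrow> (\<forall>xs\<in>nonempty_words Y. \<forall>\<epsilon>>0. \<exists>ys\<in>nonempty_words Y.
        word_dist N xs ys < \<epsilon> \<and>
        complex_of_real E \<notin> l2_spectrum (schroedinger k (periodic_ext ys))))"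

definition gap_rich ::
  "nat \<Rightarrow> ((nat \<Rightarrow> real) \<Rightarrow> real) \<Rightarrow> (nat \<Rightarrow> real) set \<Rightarrow> bool" where
  "gap_rich k N Y \<longleftrightarrow> (\<exists>S. gap_rich_with k N Y S)"

end

(* An energy E lies outside the spectrum of the periodic operator as soon as the monodromy matrix has
   |trace| > 2: the two Floquet solutions then decay exponentially at +\<infinity> and -\<infinity> and give an
   exponentially decaying Green's function, which is bounded on l^2 by the Schur test.

   Let D(b, E) be the upper left entry of the transfer matrix of b; it is a monic polynomial in E,
   and its zeros form the exceptional set. If D(b, E) is nonzero, then perturbing the free
   entries one after the other makes the upper left entry c of the transfer matrix R of everything
   but the first entry t of a word nonzero. The monodromy A(t) = T(t) R has a trace that is affine in
   t with slope -c. If |trace| <= 2, move t slightly such that A(t) is elliptic with A(t)^q = 1 or -1;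
   then the word A(t - s) A(t)^(q-2) A(t + s) has |trace| = 2 + s^2 c^2. *)

theory Submission
  imports Defs
begin

subsection \<open>Transfer matrices\<close>

text \<open>Nearby words of the same length need not open a gap at E: when the trace lies well
  inside (-2, 2), small changes keep it there. What remains is the freedom of length. Distances are
  taken between periodic extensions, so a concatenation of any number of perturbed copies of a word
  is as close to it as each copy is. Long products of matrices A(t) with t near t0 are therefore
  available, and a rational rotation number provides the inverse of A among them, up to sign, as a
  positive power. The final word is, up to sign, a commutator of that inverse with a unipotent
  matrix fixing the first basis vector. The lower left entry of A is -c, so c tells whether A moves
  the line fixed by the unipotent matrix; nothing else can make the commutator degenerate. The fixed
  entries b are the obstacle: nonvanishing of an upper left entry can be carried across a free
  entry, but a block b between two free blocks offers nothing to perturb and must have a nonzero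
  entry of its own. This is where D(b, E) comes from.\<close>

datatype mat2 = Mat2 (m11: real) (m12: real) (m21: real) (m22: real)

instantiation mat2 :: monoid_mult
begin

definition "1 = Mat2 1 0 0 1"

definition "A * B =
  Mat2 (m11 A * m11 B + m12 A * m21 B) (m11 A * m12 B + m12 A * m22 B)
       (m21 A * m11 B + m22 A * m21 B) (m21 A * m12 B + m22 A * m22 B)"

instance
  by standard (simp_all add: one_mat2_def times_mat2_def algebra_simps)

end

lemma mat2_entries_one [simp]: "m11 1 = 1" "m12 1 = 0" "m21 1 = 0" "m22 1 = 1"
  by (simp_all add: one_mat2_def)

lemma mat2_entries_times [simp]:
  "m11 (A * B) = m11 A * m11 B + m12 A * m21 B"
  "m12 (A * B) = m11 A * m12 B + m12 A * m22 B"
  "m21 (A * B) = m21 A * m11 B + m22 A * m21 B"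
  "m22 (A * B) = m21 A * m12 B + m22 A * m22 B"
  by (simp_all add: times_mat2_def)

definition mat2_trace :: "mat2 \<Rightarrow> real" where
  "mat2_trace A = m11 A + m22 A"

definition mat2_det :: "mat2 \<Rightarrow> real" where
  "mat2_det A = m11 A * m22 A - m12 A * m21 A"

lemma mat2_det_one [simp]: "mat2_det 1 = 1"
  by (simp add: mat2_det_def)

lemma mat2_det_times [simp]: "mat2_det (A * B) = mat2_det A * mat2_det B"
  by (simp add: mat2_det_def algebra_simps)

text \<open>By Cayley-Hamilton \<open>A ^ Suc p\<close> equals U_p(cos \<theta>) A - U_(p-1)(cos
  \<theta>), where U_p is the Chebyshev polynomial of the second kind, sin \<theta> U_p(cos
  \<theta>) = sin ((p+1) \<theta>). Multiplying by sin \<theta> keeps the induction free of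
  division.\<close>

lemma sin_mult_power_mat2:
  fixes A :: mat2
  assumes det: "mat2_det A = 1" and tr: "mat2_trace A = 2 * cos \<theta>"
  shows "sin \<theta> * m11 (A ^ Suc p) = sin (real (Suc p) * \<theta>) * m11 A - sin (real p * \<theta>)"
    and "sin \<theta> * m12 (A ^ Suc p) = sin (real (Suc p) * \<theta>) * m12 A"
    and "sin \<theta> * m21 (A ^ Suc p) = sin (real (Suc p) * \<theta>) * m21 A"
    and "sin \<theta> * m22 (A ^ Suc p) = sin (real (Suc p) * \<theta>) * m22 A - sin (real p * \<theta>)"
proof -
  have "sin \<theta> * m11 (A ^ Suc p) = sin (real (Suc p) * \<theta>) * m11 A - sin (real p * \<theta>) \<and>
    sin \<theta> * m12 (A ^ Suc p) = sin (real (Suc p) * \<theta>) * m12 A \<and>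
    sin \<theta> * m21 (A ^ Suc p) = sin (real (Suc p) * \<theta>) * m21 A \<and>
    sin \<theta> * m22 (A ^ Suc p) = sin (real (Suc p) * \<theta>) * m22 A - sin (real p * \<theta>)"
  proof (induction p)
    case 0
    then show ?case by simp
  next
    case (Suc p)
    obtain a b c d where A: "A = Mat2 a b c d" by (cases A)
    define S0 S1 S2 where "S0 = sin (real p * \<theta>)" and "S1 = sin (real (Suc p) * \<theta>)"
      and "S2 = sin (real (Suc (Suc p)) * \<theta>)"
    obtain x y z w where X: "A ^ Suc p = Mat2 x y z w" by (cases "A ^ Suc p")
    have X2: "A ^ Suc (Suc p) = Mat2 x y z w * A"
      unfolding X[symmetric] by (simp only: power_Suc2)
    have rec: "S2 = 2 * cos \<theta> * S1 - S0"
    proof -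
      have "S2 = sin (real (Suc p) * \<theta> + \<theta>)" "S0 = sin (real (Suc p) * \<theta> - \<theta>)"
        unfolding S0_def S2_def by (simp_all add: algebra_simps)
      then show ?thesis unfolding S1_def by (simp add: sin_add sin_diff)
    qed
    have IH: "sin \<theta> * x = S1 * a - S0" "sin \<theta> * y = S1 * b"
      "sin \<theta> * z = S1 * c" "sin \<theta> * w = S1 * d - S0"
      using Suc.IH unfolding X S0_def[symmetric] S1_def[symmetric] by (simp_all add: A)
    \<comment> \<open>These two equations carry Cayley-Hamilton, A^2 = (tr A) A - 1, into the
      entries.\<close>
    have ad: "a * d - b * c = 1" and td: "2 * cos \<theta> = a + d"
      using det tr by (simp_all add: A mat2_det_def mat2_trace_def)
    have "sin \<theta> * (x * a + y * c) = S2 * a - S1" "sin \<theta> * (x * b + y * d) = S2 * b"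
      "sin \<theta> * (z * a + w * c) = S2 * c" "sin \<theta> * (z * b + w * d) = S2 * d - S1"
      unfolding rec td using IH ad by algebra+
    then show ?case
      unfolding X2 S1_def[symmetric] S2_def[symmetric] by (simp add: A)
  qed
  then show "sin \<theta> * m11 (A ^ Suc p) = sin (real (Suc p) * \<theta>) * m11 A - sin (real p * \<theta>)"
    and "sin \<theta> * m12 (A ^ Suc p) = sin (real (Suc p) * \<theta>) * m12 A"
    and "sin \<theta> * m21 (A ^ Suc p) = sin (real (Suc p) * \<theta>) * m21 A"
    and "sin \<theta> * m22 (A ^ Suc p) = sin (real (Suc p) * \<theta>) * m22 A - sin (real p * \<theta>)"
    by auto
qed

text \<open>An elliptic matrix with a rational rotation number satisfies \<open>A\<^sup>p\<^sup>+\<^sup>2 = \<sigma>\<close> with \<open>\<sigma> = \<plusminus>1\<close>,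
  so its power \<open>A\<^sup>p\<^sup>+\<^sup>1\<close> is the inverse of \<open>A\<close> up to a sign.\<close>

lemma power_mat2_rational_rotation:
  fixes A :: mat2
  assumes det: "mat2_det A = 1" and tr: "mat2_trace A = 2 * cos \<theta>"
    and sin: "sin \<theta> \<noteq> 0" and \<theta>: "real (Suc (Suc p)) * \<theta> = pi * real r"
  shows "A ^ Suc p = Mat2 ((-1)^r * m22 A) (- ((-1)^r * m12 A)) (- ((-1)^r * m21 A)) ((-1)^r * m11 A)"
proof -
  define \<sigma> :: real where "\<sigma> = (-1) ^ r"
  \<comment> \<open>With q = p + 2 and q \<theta> = \<pi> r, the sines at (q-1) \<theta> and (q-2)
    \<theta> reduce to multiples of sin \<theta>.\<close>
  have "real (Suc p) * \<theta> = pi * real r - \<theta>"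
    using \<theta> by (simp add: algebra_simps)
  then have S1: "sin (real (Suc p) * \<theta>) = - \<sigma> * sin \<theta>"
    by (simp add: sin_diff \<sigma>_def cos_npi2 sin_npi2)
  have "real p * \<theta> = pi * real r - 2 * \<theta>"
    using \<theta> by (simp add: algebra_simps)
  then have S0: "sin (real p * \<theta>) = - \<sigma> * (2 * sin \<theta> * cos \<theta>)"
    by (simp add: sin_diff \<sigma>_def cos_npi2 sin_npi2 sin_double)
  have td: "2 * cos \<theta> = m11 A + m22 A"
    using tr by (simp add: mat2_trace_def)
  have "sin \<theta> * m11 (A ^ Suc p) = sin \<theta> * (\<sigma> * m22 A)"
    unfolding sin_mult_power_mat2(1)[OF det tr] S0 S1 using td by algebra
  moreover have "sin \<theta> * m12 (A ^ Suc p) = sin \<theta> * (- (\<sigma> * m12 A))"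
    unfolding sin_mult_power_mat2(2)[OF det tr] S1 by simp
  moreover have "sin \<theta> * m21 (A ^ Suc p) = sin \<theta> * (- (\<sigma> * m21 A))"
    unfolding sin_mult_power_mat2(3)[OF det tr] S1 by simp
  moreover have "sin \<theta> * m22 (A ^ Suc p) = sin \<theta> * (\<sigma> * m11 A)"
    unfolding sin_mult_power_mat2(4)[OF det tr] S0 S1 using td by algebra
  ultimately show ?thesis
    using sin unfolding \<sigma>_def[symmetric] by (intro mat2.expand) (simp only: mult_left_cancel mat2.sel simp_thms)
qed

section \<open>Transfer matrices of words and their upper left entry\<close>

definition transfer_mat :: "real \<Rightarrow> real \<Rightarrow> mat2" where
  "transfer_mat E v = Mat2 (E - v) 1 (-1) 0"

text \<open>\<open>transfer_mat\<close> is the transpose of the customary one-step matrix: it acts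
  from the right on the row vector (\<psi>(n), \<psi>(n-1)) and yields (\<psi>(n+1), \<psi>(n)). The
  factors thus stand in the order of the word.\<close>

definition transfer_word :: "real \<Rightarrow> real list \<Rightarrow> mat2" where
  "transfer_word E vs = prod_list (map (transfer_mat E) vs)"

lemma transfer_word_simps [simp]:
  "transfer_word E [] = 1"
  "transfer_word E (v # vs) = transfer_mat E v * transfer_word E vs"
  "transfer_word E (vs @ ws) = transfer_word E vs * transfer_word E ws"
  by (simp_all add: transfer_word_def)

lemma mat2_det_transfer_mat [simp]: "mat2_det (transfer_mat E v) = 1"
  by (simp add: transfer_mat_def mat2_det_def)

lemma mat2_det_transfer_word [simp]: "mat2_det (transfer_word E vs) = 1"
  by (induction vs) simp_all

text \<open>The first column evolves by p -> (X - v) p + q, q -> -p. Tracking that q has smaller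
  degree than p excludes cancellation of the leading term; q = 0 is listed apart because its degree
  counts as 0.\<close>

lemma transfer_word_entries_poly:
  "\<exists>p q :: real poly. p \<noteq> 0 \<and> (q = 0 \<or> degree q < degree p) \<and>
     (\<forall>E. m11 (transfer_word E vs) = poly p E \<and> m21 (transfer_word E vs) = poly q E)"
proof (induction vs)
  case Nil
  show ?case by (intro exI[of _ 1] exI[of _ 0]) simp
next
  case (Cons v vs)
  then obtain p q :: "real poly" where p: "p \<noteq> 0" and q: "q = 0 \<or> degree q < degree p"
    and pq: "\<And>E. m11 (transfer_word E vs) = poly p E" "\<And>E. m21 (transfer_word E vs) = poly q E"
    by blast
  have deg: "degree ([:-v, 1:] * p) = Suc (degree p)"
    using p by (subst degree_mult_eq) auto
  then have "degree ([:-v, 1:] * p + q) = Suc (degree p)"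
    using q by (subst degree_add_eq_left) auto
  then show ?case
    by (intro exI[of _ "[:-v, 1:] * p + q"] exI[of _ "- p"])
      (auto simp: transfer_mat_def pq algebra_simps)
qed

lemma finite_m11_transfer_word_zero: "finite {E. m11 (transfer_word E vs) = 0}"
proof -
  obtain p :: "real poly" where "p \<noteq> 0" "\<And>E. m11 (transfer_word E vs) = poly p E"
    using transfer_word_entries_poly[of vs] by blast
  then show ?thesis using poly_roots_finite[of p] by simp
qed

text \<open>The entry is affine in the perturbed potential value, with slope \<open>- m11 A * m11 Q\<close>.\<close>

lemma perturb_m11_transfer_mat:
  assumes "m11 A \<noteq> 0" "m11 Q \<noteq> 0" "\<delta> > 0"
  obtains x' where "\<bar>x' - x\<bar> < \<delta>" "m11 (A * (transfer_mat E x' * Q)) \<noteq> 0"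
proof (cases "m11 (A * (transfer_mat E x * Q)) = 0")
  case False
  then show ?thesis using assms(3) by (intro that[of x]) auto
next
  case True
  have "m11 (A * (transfer_mat E (x + \<delta>/2) * Q))
      = m11 (A * (transfer_mat E x * Q)) - \<delta>/2 * (m11 A * m11 Q)"
    by (simp add: transfer_mat_def algebra_simps)
  then show ?thesis using assms True by (intro that[of "x + \<delta>/2"]) auto
qed

text \<open>The entries are adjusted from right to left. Nothing stands to the left of the entry
  being adjusted, so the left factor is 1, whose upper left entry is nonzero.\<close>

lemma perturb_m11_transfer_word:
  assumes "m11 Q \<noteq> 0" "\<delta> > 0"
  obtains xs' where "list_all2 (\<lambda>x x'. \<bar>x' - x\<bar> < \<delta>) xs xs'" "m11 (transfer_word E xs' * Q) \<noteq> 0"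
proof (induction xs arbitrary: thesis)
  case Nil
  then show ?case using assms by auto
next
  case (Cons x xs)
  obtain xs' where xs': "list_all2 (\<lambda>x x'. \<bar>x' - x\<bar> < \<delta>) xs xs'" "m11 (transfer_word E xs' * Q) \<noteq> 0"
    using Cons.IH by blast
  obtain x' where x': "\<bar>x' - x\<bar> < \<delta>" "m11 (1 * (transfer_mat E x' * (transfer_word E xs' * Q))) \<noteq> 0"
    using perturb_m11_transfer_mat[of 1, OF _ xs'(2) assms(2)] by auto
  show ?case using xs' x' by (intro Cons.prems[of "x' # xs'"]) (auto simp: mult.assoc)
qed

text \<open>Only the first entry has to mediate between A and the rest; the others are adjusted
  beforehand against Q alone. At least one free entry is essential, since \<open>m11 (A * Q)\<close>
  may vanish although \<open>m11 A\<close> and \<open>m11 Q\<close> do not.\<close>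

lemma perturb_m11_mult_transfer_word:
  assumes "m11 A \<noteq> 0" "m11 Q \<noteq> 0" "\<delta> > 0" "xs \<noteq> []"
  obtains xs' where "list_all2 (\<lambda>x x'. \<bar>x' - x\<bar> < \<delta>) xs xs'"
    "m11 (A * (transfer_word E xs' * Q)) \<noteq> 0"
proof -
  obtain x ys where xs: "xs = x # ys" using assms(4) by (cases xs) auto
  obtain ys' where ys': "list_all2 (\<lambda>x x'. \<bar>x' - x\<bar> < \<delta>) ys ys'" "m11 (transfer_word E ys' * Q) \<noteq> 0"
    using perturb_m11_transfer_word[OF assms(2,3)] by blast
  obtain x' where "\<bar>x' - x\<bar> < \<delta>" "m11 (A * (transfer_mat E x' * (transfer_word E ys' * Q))) \<noteq> 0"
    using perturb_m11_transfer_mat[OF assms(1) ys'(2) assms(3)] by blast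
  then show ?thesis using ys' by (intro that[of "x' # ys'"]) (auto simp: xs mult.assoc)
qed

text \<open>On [0, 1] the map t -> 2 cos (\<pi> t) is strictly decreasing, so the interval pulls
  back under arccos to one that contains a rational r/q. From 0 < r < q follows q \<ge> 2, hence the
  form \<open>Suc (Suc p)\<close>.\<close>

lemma rational_rotation_dense:
  fixes a b :: real
  assumes "a < b" "- 2 \<le> a" "b \<le> 2"
  obtains p r where "0 < r" "r < Suc (Suc p)"
    "a < 2 * cos (pi * real r / real (Suc (Suc p)))" "2 * cos (pi * real r / real (Suc (Suc p))) < b"
proof -
  have "arccos (b / 2) < arccos (a / 2)"
    using assms by (intro arccos_less_arccos) auto
  then have "arccos (b / 2) / pi < arccos (a / 2) / pi"
    by (simp add: divide_strict_right_mono)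
  then obtain t where t: "t \<in> \<rat>" "arccos (b / 2) / pi < t" "t < arccos (a / 2) / pi"
    using Rats_dense_in_real by blast
  have t1: "arccos (b / 2) < pi * t" "pi * t < arccos (a / 2)"
    using t by (simp_all add: field_simps)
  have "0 \<le> arccos (b / 2)" "arccos (a / 2) \<le> pi"
    using assms by (auto intro: arccos_lbound arccos_ubound)
  then have "0 < pi * t" "pi * t < pi * 1"
    using t1 by linarith+
  then have t01: "0 < t" "t < 1"
    by (simp_all add: zero_less_mult_iff)
  obtain r q :: nat where q: "q \<noteq> 0" "\<bar>t\<bar> = real r / real q"
    using t(1) by (metis Rats_abs_nat_div_natE)
  then have t_eq: "t = real r / real q" using t01 by simp
  have rq: "0 < r" "r < q"
    using t01 q(1) unfolding t_eq by (simp_all add: field_simps)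
  then obtain p where p: "q = Suc (Suc p)"
    by (metis Suc_pred gr0_conv_Suc less_Suc0 less_nat_zero_code not_gr_zero)
  have ca: "cos (arccos (a / 2)) = a / 2" and cb: "cos (arccos (b / 2)) = b / 2"
    using assms by (simp_all add: cos_arccos)
  have "cos (arccos (a / 2)) < cos (pi * t)" "cos (pi * t) < cos (arccos (b / 2))"
    using t1 \<open>0 < pi * t\<close> \<open>pi * t < pi * 1\<close> \<open>0 \<le> arccos (b / 2)\<close> \<open>arccos (a / 2) \<le> pi\<close>
    by (auto intro!: cos_monotone_0_pi)
  then have "a < 2 * cos (pi * t)" "2 * cos (pi * t) < b"
    unfolding ca cb by linarith+
  then show ?thesis using rq that[of r p] by (simp add: t_eq p)
qed

text \<open>Once the trace is \<open>2 cos (\<pi> r / q)\<close>, \<open>A\<^sup>q\<^sup>-\<^sup>1 = \<plusminus>A\<^sup>-\<^sup>1\<close>; with the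
  unipotent \<open>U s\<close> satisfying \<open>A (t - s) = U s * A t\<close> the word
  \<open>A (t - s) A(t)\<^sup>q\<^sup>-\<^sup>2 A (t + s) = \<plusminus> U s * A\<^sup>-\<^sup>1 * U (-s) * A\<close> has trace \<open>\<plusminus>(2 + s\<^sup>2 * (m11 R)\<^sup>2)\<close>.\<close>

lemma hyperbolic_perturbation:
  assumes det: "mat2_det R = 1" and R: "m11 R \<noteq> 0" and \<delta>: "\<delta> > 0"
  obtains ts where "ts \<noteq> []" "\<forall>t\<in>set ts. \<bar>t - t0\<bar> < \<delta>"
    "\<bar>mat2_trace (prod_list (map (\<lambda>t. transfer_mat E t * R) ts))\<bar> > 2"
proof (cases "\<bar>mat2_trace (transfer_mat E t0 * R)\<bar> > 2")
  case True
  then show ?thesis using \<delta> by (intro that[of "[t0]"]) auto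
next
  case False
  define c where "c = m11 R"
  have c0: "\<bar>c\<bar> > 0" using R by (simp add: c_def)
  define \<tau> where "\<tau> = mat2_trace (transfer_mat E t0 * R)"
  have tr: "mat2_trace (transfer_mat E t * R) = \<tau> - (t - t0) * c" for t
    by (simp add: \<tau>_def mat2_trace_def transfer_mat_def c_def algebra_simps)
  have tau: "- 2 \<le> \<tau>" "\<tau> \<le> 2" using False by (auto simp: \<tau>_def)
  have "\<delta> * \<bar>c\<bar> > 0" using c0 \<delta> by simp
  \<comment> \<open>The traces reached for |t - t0| < \<delta> form an interval around \<tau>; it is
    cut down to [-2, 2], where elliptic matrices live.\<close>
  then have lt: "max (-2) (\<tau> - \<delta> * \<bar>c\<bar>) < min 2 (\<tau> + \<delta> * \<bar>c\<bar>)"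
    using tau by simp
  obtain p r where r: "0 < r" "r < Suc (Suc p)"
    and pr: "max (-2) (\<tau> - \<delta> * \<bar>c\<bar>) < 2 * cos (pi * real r / real (Suc (Suc p)))"
      "2 * cos (pi * real r / real (Suc (Suc p))) < min 2 (\<tau> + \<delta> * \<bar>c\<bar>)"
    using rational_rotation_dense[OF lt max.cobounded1 min.cobounded1] by blast
  define \<theta> where "\<theta> = pi * real r / real (Suc (Suc p))"
  \<comment> \<open>Solves \<tau> - (t1 - t0) c = 2 cos \<theta>.\<close>
  define t1 where "t1 = t0 + (\<tau> - 2 * cos \<theta>) / c"
  have "\<bar>\<tau> - 2 * cos \<theta>\<bar> < \<delta> * \<bar>c\<bar>"
    using pr unfolding \<theta>_def by linarith
  then have t1: "\<bar>t1 - t0\<bar> < \<delta>"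
    using c0 by (simp add: t1_def abs_divide divide_less_eq)
  \<comment> \<open>Half of the room that is left, so that t1 - s and t1 + s stay within \<delta> of
    t0.\<close>
  define s where "s = (\<delta> - \<bar>t1 - t0\<bar>) / 2"
  have s: "s > 0" using t1 by (simp add: s_def)
  define A where "A = transfer_mat E t1 * R"
  have detA: "mat2_det A = 1" using det by (simp add: A_def)
  have trA: "mat2_trace A = 2 * cos \<theta>"
    using c0 by (simp add: A_def tr t1_def)
  have "0 < \<theta>" using r by (simp add: \<theta>_def)
  moreover have "\<theta> < pi"
    using r by (simp add: \<theta>_def field_simps del: of_nat_Suc)
  ultimately have sin: "sin \<theta> \<noteq> 0" using sin_gt_zero by fastforce
  have th: "real (Suc (Suc p)) * \<theta> = pi * real r"
    by (simp add: \<theta>_def del: of_nat_Suc)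
  define \<sigma> :: real where "\<sigma> = (-1) ^ r"
  have pow: "A ^ Suc p = Mat2 (\<sigma> * m22 A) (- (\<sigma> * m12 A)) (- (\<sigma> * m21 A)) (\<sigma> * m11 A)"
    unfolding \<sigma>_def by (rule power_mat2_rational_rotation[OF detA trA sin th])
  define U where "U = (\<lambda>x. Mat2 1 (- x) 0 1)"
  have shift: "transfer_mat E (t1 + x) * R = U (- x) * A" "transfer_mat E (t1 - x) * R = U x * A" for x
    by (rule mat2.expand, simp add: A_def U_def transfer_mat_def algebra_simps)+
  define ts where "ts = (t1 - s) # replicate p t1 @ [t1 + s]"
  have "prod_list (map (\<lambda>t. transfer_mat E t * R) ts) = U s * A * A ^ p * (U (- s) * A)"
    by (simp add: ts_def shift prod_list_replicate mult.assoc flip: A_def)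
  also have "\<dots> = U s * A ^ Suc p * (U (- s) * A)"
    by (simp add: mult.assoc)
  finally have W: "prod_list (map (\<lambda>t. transfer_mat E t * R) ts) = U s * A ^ Suc p * (U (- s) * A)" .
  \<comment> \<open>A commutator up to sign: \<open>U (- s)\<close> is the inverse of
    \<open>U s\<close>, and \<open>A ^ Suc p\<close> is \<sigma> times the inverse of A.\<close>
  have "mat2_trace (U s * A ^ Suc p * (U (- s) * A)) =
      \<sigma> * (2 * mat2_det A + s^2 * (m21 A)^2)"
    unfolding pow U_def by (simp add: mat2_trace_def mat2_det_def power2_eq_square algebra_simps)
  moreover have "m21 A = - c" by (simp add: A_def transfer_mat_def c_def)
  ultimately have "\<bar>mat2_trace (prod_list (map (\<lambda>t. transfer_mat E t * R) ts))\<bar> = \<bar>2 + s^2 * c^2\<bar>"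
    by (simp add: W detA abs_mult \<sigma>_def)
  moreover have "s^2 * c^2 > 0" using s c0 by simp
  moreover have "\<forall>t\<in>set ts. \<bar>t - t0\<bar> < \<delta>"
  proof -
    have "\<bar>t1 - s - t0\<bar> < \<delta>" "\<bar>t1 + s - t0\<bar> < \<delta>"
      using t1 unfolding s_def by (auto simp: abs_if field_simps split: if_splits)
    then show ?thesis using t1 by (auto simp: ts_def)
  qed
  ultimately show ?thesis by (intro that[of ts]) (auto simp: ts_def)
qed

subsection \<open>Bounded invertibility from an exponential dichotomy\<close>

lemma l2_norm_nonneg: "l2_norm \<psi> \<ge> 0"
  by (simp add: l2_norm_def infsum_nonneg)

lemma l2_norm_power2: "(l2_norm \<psi>)\<^sup>2 = (\<Sum>\<^sub>\<infinity>n. (norm (\<psi> n))\<^sup>2)"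
  by (simp add: l2_norm_def infsum_nonneg)

lemma l2_summable: "\<psi> \<in> l2 \<Longrightarrow> (\<lambda>n. (norm (\<psi> n))\<^sup>2) summable_on UNIV"
  by (simp add: l2_def)

lemma l2_boundedI:
  assumes B: "B \<ge> 0" and "\<And>F. finite F \<Longrightarrow> (\<Sum>n\<in>F. (norm (\<psi> n))\<^sup>2) \<le> B\<^sup>2"
  shows "\<psi> \<in> l2" "l2_norm \<psi> \<le> B"
proof -
  show l2: "\<psi> \<in> l2"
    unfolding l2_def using assms(2)
    by (intro CollectI nonneg_bdd_above_summable_on) (auto intro!: bdd_aboveI2)
  have "(\<Sum>\<^sub>\<infinity>n. (norm (\<psi> n))\<^sup>2) \<le> B\<^sup>2"
    using l2_summable[OF l2] assms(2) by (rule infsum_le_finite_sums)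
  then show "l2_norm \<psi> \<le> B"
    using B by (simp add: l2_norm_def real_le_lsqrt infsum_nonneg)
qed

lemma norm_le_l2_norm:
  assumes "\<psi> \<in> l2"
  shows "norm (\<psi> n) \<le> l2_norm \<psi>"
proof -
  have "(\<Sum>i\<in>{n}. (norm (\<psi> i))\<^sup>2) \<le> (\<Sum>\<^sub>\<infinity>i. (norm (\<psi> i))\<^sup>2)"
    using l2_summable[OF assms] by (intro finite_sum_le_infsum) auto
  then have "(norm (\<psi> n))\<^sup>2 \<le> (l2_norm \<psi>)\<^sup>2"
    by (simp add: l2_norm_power2)
  then show ?thesis using l2_norm_nonneg by (rule power2_le_imp_le)
qed

lemma l2_add:
  assumes "\<phi> \<in> l2" "\<psi> \<in> l2"
  shows "(\<lambda>n. \<phi> n + \<psi> n) \<in> l2"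
proof -
  have "(\<lambda>n. 2 * (norm (\<phi> n))\<^sup>2 + 2 * (norm (\<psi> n))\<^sup>2) summable_on UNIV"
    using assms by (intro summable_on_add summable_on_cmult_right l2_summable)
  then have "(\<lambda>n. (norm (\<phi> n + \<psi> n))\<^sup>2) summable_on UNIV"
  proof (rule summable_on_comparison_test)
    fix n
    have "(norm (\<phi> n + \<psi> n))\<^sup>2 \<le> (norm (\<phi> n) + norm (\<psi> n))\<^sup>2"
      by (intro power_mono norm_triangle_ineq) auto
    also have "\<dots> \<le> 2 * (norm (\<phi> n))\<^sup>2 + 2 * (norm (\<psi> n))\<^sup>2"
      using zero_le_power2[of "norm (\<phi> n) - norm (\<psi> n)"] by (simp add: power2_eq_square algebra_simps)
    finally show "(norm (\<phi> n + \<psi> n))\<^sup>2 \<le> 2 * (norm (\<phi> n))\<^sup>2 + 2 * (norm (\<psi> n))\<^sup>2" .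
  qed auto
  then show ?thesis by (simp add: l2_def)
qed

lemma l2_translate:
  assumes "\<psi> \<in> l2"
  shows "(\<lambda>n. \<psi> (n + c)) \<in> l2"
proof -
  have "((\<lambda>n. (norm (\<psi> n))\<^sup>2) \<circ> (\<lambda>n. n + c)) summable_on UNIV"
    using l2_summable[OF assms] by (subst summable_on_reindex[symmetric]) auto
  then show ?thesis by (simp add: l2_def o_def)
qed

lemma l2_mult_bounded:
  assumes "\<psi> \<in> l2" and "\<And>n. norm (a n) \<le> B"
  shows "(\<lambda>n. a n * \<psi> n) \<in> l2"
proof -
  have "(\<lambda>n. B\<^sup>2 * (norm (\<psi> n))\<^sup>2) summable_on UNIV"
    using assms(1) by (intro summable_on_cmult_right l2_summable)
  then have "(\<lambda>n. (norm (a n * \<psi> n))\<^sup>2) summable_on UNIV"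
    by (rule summable_on_comparison_test)
      (auto simp: norm_mult power_mult_distrib intro!: mult_right_mono power_mono assms(2))
  then show ?thesis by (simp add: l2_def)
qed

text \<open>Splitting |k| into two square roots, Cauchy-Schwarz bounds |\<Sum> k f|^2 by (\<Sum>
  |k|) (\<Sum> |k| |f|^2). The row bound controls the first factor; after summation over n, the
  column bound controls the second.\<close>

lemma Schur_test_l2:
  fixes k :: "int \<Rightarrow> int \<Rightarrow> complex"
  assumes row: "\<And>n F. finite F \<Longrightarrow> (\<Sum>m\<in>F. norm (k n m)) \<le> A"
    and col: "\<And>m F. finite F \<Longrightarrow> (\<Sum>n\<in>F. norm (k n m)) \<le> A"
    and f: "f \<in> l2"
  shows "(\<lambda>m. k n m * f m) summable_on UNIV"
    and "(\<lambda>n. \<Sum>\<^sub>\<infinity>m. k n m * f m) \<in> l2"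
    and "l2_norm (\<lambda>n. \<Sum>\<^sub>\<infinity>m. k n m * f m) \<le> A * l2_norm f"
proof -
  have A0: "A \<ge> 0" using row[of "{}"] by simp
  have kA: "norm (k n m) \<le> A" for n m using row[of "{m}" n] by simp
  have abs: "(\<lambda>m. norm (k n m * f m)) summable_on UNIV" for n
  proof (rule nonneg_bdd_above_summable_on)
    show "bdd_above (sum (\<lambda>m. norm (k n m * f m)) ` {F. F \<subseteq> UNIV \<and> finite F})"
    proof (rule bdd_aboveI2)
      fix F :: "int set" assume "F \<in> {F. F \<subseteq> UNIV \<and> finite F}"
      then have "(\<Sum>m\<in>F. norm (k n m * f m)) \<le> (\<Sum>m\<in>F. norm (k n m) * l2_norm f)"
        by (intro sum_mono) (auto simp: norm_mult intro!: mult_left_mono norm_le_l2_norm[OF f])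
      also have "\<dots> \<le> A * l2_norm f"
        unfolding sum_distrib_right[symmetric]
        using \<open>F \<in> _\<close> by (intro mult_right_mono row l2_norm_nonneg) auto
      finally show "(\<Sum>m\<in>F. norm (k n m * f m)) \<le> A * l2_norm f" .
    qed
  qed auto
  show "(\<lambda>m. k n m * f m) summable_on UNIV" for n
    using abs by (rule abs_summable_summable)
  define T where "T = (\<lambda>n. \<Sum>\<^sub>\<infinity>m. norm (k n m) * (norm (f m))\<^sup>2)"
  have Asum: "(\<lambda>m. A * (norm (f m))\<^sup>2) summable_on UNIV"
    using f by (intro summable_on_cmult_right l2_summable)
  have Tsum: "(\<lambda>m. norm (k n m) * (norm (f m))\<^sup>2) summable_on UNIV" for n
    by (rule summable_on_comparison_test[OF Asum]) (auto intro!: mult_right_mono kA)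
  have T0: "T n \<ge> 0" for n by (simp add: T_def infsum_nonneg)
  have pointwise: "(norm (\<Sum>\<^sub>\<infinity>m. k n m * f m))\<^sup>2 \<le> A * T n" for n
  proof -
    have "(\<Sum>m\<in>F. norm (k n m * f m)) \<le> sqrt (A * T n)" if F: "finite F" for F
    proof (rule real_le_rsqrt)
      have "(\<Sum>m\<in>F. norm (k n m * f m))\<^sup>2
          = (\<Sum>m\<in>F. sqrt (norm (k n m)) * (sqrt (norm (k n m)) * norm (f m)))\<^sup>2"
        by (simp add: norm_mult mult.assoc[symmetric])
      also have "\<dots> \<le> (\<Sum>m\<in>F. (sqrt (norm (k n m)))\<^sup>2) * (\<Sum>m\<in>F. (sqrt (norm (k n m)) * norm (f m))\<^sup>2)"
        by (rule Cauchy_Schwarz_ineq_sum)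
      also have "\<dots> = (\<Sum>m\<in>F. norm (k n m)) * (\<Sum>m\<in>F. norm (k n m) * (norm (f m))\<^sup>2)"
        by (simp add: power_mult_distrib)
      also have "\<dots> \<le> A * T n"
        unfolding T_def
        by (intro mult_mono row F finite_sum_le_infsum Tsum) (auto intro!: sum_nonneg A0)
      finally show "(\<Sum>m\<in>F. norm (k n m * f m))\<^sup>2 \<le> A * T n" .
    qed
    then have "(\<Sum>\<^sub>\<infinity>m. norm (k n m * f m)) \<le> sqrt (A * T n)"
      by (intro infsum_le_finite_sums abs) auto
    then have "norm (\<Sum>\<^sub>\<infinity>m. k n m * f m) \<le> sqrt (A * T n)"
      using norm_infsum_bound[OF abs[of n]] by linarith
    then have "(norm (\<Sum>\<^sub>\<infinity>m. k n m * f m))\<^sup>2 \<le> (sqrt (A * T n))\<^sup>2"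
      by (intro power_mono) auto
    then show ?thesis using A0 T0 by simp
  qed
  \<comment> \<open>Over a finite set of rows the column bound acts inside a single infinite sum, so
    no two infinite sums need to be interchanged.\<close>
  have total: "(\<Sum>n\<in>F. T n) \<le> A * (l2_norm f)\<^sup>2" if F: "finite F" for F
  proof (rule has_sum_mono)
    show "((\<lambda>m. \<Sum>n\<in>F. norm (k n m) * (norm (f m))\<^sup>2) has_sum (\<Sum>n\<in>F. T n)) UNIV"
      using F
    proof (induction F)
      case (insert n F)
      then show ?case
        by (simp add: has_sum_add T_def has_sum_infsum[OF Tsum])
    qed simp
    show "((\<lambda>m. A * (norm (f m))\<^sup>2) has_sum A * (l2_norm f)\<^sup>2) UNIV"
      unfolding l2_norm_power2
      by (intro has_sum_cmult_right has_sum_infsum l2_summable f)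
    show "(\<Sum>n\<in>F. norm (k n m) * (norm (f m))\<^sup>2) \<le> A * (norm (f m))\<^sup>2" for m
      unfolding sum_distrib_right[symmetric] by (intro mult_right_mono col F) auto
  qed
  have fin: "(\<Sum>n\<in>F. (norm (\<Sum>\<^sub>\<infinity>m. k n m * f m))\<^sup>2) \<le> (A * l2_norm f)\<^sup>2" if F: "finite F" for F
  proof -
    have "(\<Sum>n\<in>F. (norm (\<Sum>\<^sub>\<infinity>m. k n m * f m))\<^sup>2) \<le> (\<Sum>n\<in>F. A * T n)"
      by (intro sum_mono pointwise)
    also have "\<dots> \<le> A * (A * (l2_norm f)\<^sup>2)"
      unfolding sum_distrib_left[symmetric] by (intro mult_left_mono total F A0)
    finally show ?thesis by (simp add: power2_eq_square algebra_simps)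
  qed
  show "(\<lambda>n. \<Sum>\<^sub>\<infinity>m. k n m * f m) \<in> l2"
    and "l2_norm (\<lambda>n. \<Sum>\<^sub>\<infinity>m. k n m * f m) \<le> A * l2_norm f"
    using l2_boundedI[of "A * l2_norm f", OF _ fin] A0 l2_norm_nonneg by auto
qed

text \<open>Split F at m: on either side n -> |n - m| is injective into the naturals, so each half
  is at most a geometric series, uniformly in F and m.\<close>

lemma sum_exp_abs_int_bounded:
  fixes \<kappa> :: real
  assumes "\<kappa> > 0"
  obtains A where "A \<ge> 0" "\<And>F m. finite F \<Longrightarrow> (\<Sum>n\<in>F. exp (- \<kappa> * \<bar>real_of_int (n - m)\<bar>)) \<le> A"
proof -
  define r where "r = exp (- \<kappa>)"
  have r: "0 < r" "r < 1" using assms by (simp_all add: r_def)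
  have geo: "(\<Sum>i\<in>I. r ^ i) \<le> 1 / (1 - r)" if "finite I" for I :: "nat set"
  proof -
    have "(\<Sum>i\<in>I. r ^ i) \<le> (\<Sum>i. r ^ i)"
      using r that by (intro sum_le_suminf summable_geometric) auto
    then show ?thesis using r by (simp add: suminf_geometric)
  qed
  have ex: "exp (- \<kappa> * \<bar>real_of_int j\<bar>) = r ^ nat \<bar>j\<bar>" for j
    by (simp add: r_def flip: exp_of_nat_mult)
  have "(\<Sum>n\<in>F. exp (- \<kappa> * \<bar>real_of_int (n - m)\<bar>)) \<le> 2 / (1 - r)" if F: "finite F" for F m
  proof -
    have "(\<Sum>n\<in>F. exp (- \<kappa> * \<bar>real_of_int (n - m)\<bar>)) = (\<Sum>n\<in>F. r ^ nat \<bar>n - m\<bar>)"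
      unfolding ex ..
    also have "\<dots> = (\<Sum>n\<in>F \<inter> {m..}. r ^ nat \<bar>n - m\<bar>) + (\<Sum>n\<in>F - {m..}. r ^ nat \<bar>n - m\<bar>)"
      by (rule sum.Int_Diff[OF F])
    also have "(\<Sum>n\<in>F \<inter> {m..}. r ^ nat \<bar>n - m\<bar>) = (\<Sum>i\<in>(\<lambda>n. nat \<bar>n - m\<bar>) ` (F \<inter> {m..}). r ^ i)"
      by (subst sum.reindex) (auto simp: inj_on_def)
    also have "(\<Sum>n\<in>F - {m..}. r ^ nat \<bar>n - m\<bar>) = (\<Sum>i\<in>(\<lambda>n. nat \<bar>n - m\<bar>) ` (F - {m..}). r ^ i)"
      by (subst sum.reindex) (auto simp: inj_on_def)
    also have "(\<Sum>i\<in>(\<lambda>n. nat \<bar>n - m\<bar>) ` (F \<inter> {m..}). r ^ i) +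
        (\<Sum>i\<in>(\<lambda>n. nat \<bar>n - m\<bar>) ` (F - {m..}). r ^ i) \<le> 1 / (1 - r) + 1 / (1 - r)"
      using F by (intro add_mono geo) auto
    finally show ?thesis by (simp add: add_divide_distrib[symmetric])
  qed
  then show ?thesis using r by (intro that[of "2 / (1 - r)"]) auto
qed

section \<open>Wronskians and the Green's function\<close>

lemma int_shift_invariant_const:
  fixes h :: "int \<Rightarrow> 'a"
  assumes "\<And>n. h (n + 1) = h n"
  shows "h n = h 0"
  by (induction n rule: int_induct[where k = 0]) (use assms assms[of "_ - 1"] in auto)

lemma wronskian_const:
  fixes f g a :: "int \<Rightarrow> 'a :: comm_ring_1"
  assumes f: "\<And>n. f (n + 1) = a n * f n - f (n - 1)"
    and g: "\<And>n. g (n + 1) = a n * g n - g (n - 1)"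
  shows "f (n + 1) * g n - f n * g (n + 1) = f 1 * g 0 - f 0 * g 1"
proof -
  have "f (n + 1 + 1) * g (n + 1) - f (n + 1) * g (n + 1 + 1) = f (n + 1) * g n - f n * g (n + 1)" for n
    unfolding f[of "n + 1"] g[of "n + 1"] by (simp add: algebra_simps)
  from int_shift_invariant_const[of "\<lambda>n. f (n + 1) * g n - f n * g (n + 1)", OF this]
  show ?thesis by simp
qed

text \<open>\<open>u\<close> is the solution decaying at +\<infinity>, \<open>w\<close> the one
  decaying at -\<infinity>. Each may grow at the other end, but both bounds hold on all of Z; this
  makes u(i) w(j) decay in i - j for j \<le> i. In the application \<open>a\<close> is E minus the
  potential.\<close>

locale exponential_dichotomy =
  fixes a u w :: "int \<Rightarrow> complex" and \<kappa> C B :: real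
  assumes a_bounded: "\<And>n. norm (a n) \<le> B"
    and \<kappa>_pos: "\<kappa> > 0"
    and u_rec: "\<And>n. u (n + 1) = a n * u n - u (n - 1)"
    and w_rec: "\<And>n. w (n + 1) = a n * w n - w (n - 1)"
    and u_bound: "\<And>n. norm (u n) \<le> C * exp (- \<kappa> * real_of_int n)"
    and w_bound: "\<And>n. norm (w n) \<le> C * exp (\<kappa> * real_of_int n)"
    and wronskian_nonzero: "u 1 * w 0 - u 0 * w 1 \<noteq> 0"
begin

definition jacobi :: "(int \<Rightarrow> complex) \<Rightarrow> int \<Rightarrow> complex" where
  "jacobi \<psi> n = \<psi> (n - 1) + \<psi> (n + 1) - a n * \<psi> n"

definition W :: complex where
  "W = u 1 * w 0 - u 0 * w 1"

text \<open>The larger index goes to \<open>u\<close>, the smaller to \<open>w\<close>, so every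
  product decays off the diagonal. Division by the Wronskian normalises the jump at n = m to
  1.\<close>

definition green :: "int \<Rightarrow> int \<Rightarrow> complex" where
  "green n m = (if m \<le> n then u n * w m else u m * w n) / W"

lemma W_eq: "u (n + 1) * w n - u n * w (n + 1) = W"
  unfolding W_def by (rule wronskian_const[OF u_rec w_rec])

lemma W_nonzero: "W \<noteq> 0"
  using wronskian_nonzero by (simp add: W_def)

lemma C_nonneg: "C \<ge> 0"
  using order_trans[OF norm_ge_zero u_bound[of 0]] by simp

lemma norm_green_le: "norm (green n m) \<le> C\<^sup>2 / norm W * exp (- \<kappa> * \<bar>real_of_int (n - m)\<bar>)"
proof -
  have *: "norm (u i * w j) \<le> C\<^sup>2 * exp (- \<kappa> * \<bar>real_of_int (i - j)\<bar>)" if "j \<le> i" for i j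
  proof -
    have "norm (u i * w j) \<le> (C * exp (- \<kappa> * real_of_int i)) * (C * exp (\<kappa> * real_of_int j))"
      unfolding norm_mult using C_nonneg by (intro mult_mono u_bound w_bound) auto
    also have "\<dots> = C\<^sup>2 * exp (- \<kappa> * \<bar>real_of_int (i - j)\<bar>)"
      using that by (simp add: power2_eq_square algebra_simps exp_add[symmetric])
    finally show ?thesis .
  qed
  show ?thesis
  proof (cases "m \<le> n")
    case True
    then show ?thesis
      using divide_right_mono[OF *[OF True], of "norm W"] by (simp add: green_def norm_divide)
  next
    case False
    then show ?thesis
      using divide_right_mono[OF *[of n m], of "norm W"]
      by (simp add: green_def norm_divide abs_minus_commute)
  qed
qed

text \<open>In the variable n the kernel solves the homogeneous equation on either side of m; the
  mismatch at n = m is exactly the Wronskian.\<close>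

lemma green_equation:
  "green (n - 1) m + green (n + 1) m - a n * green n m = (if m = n then 1 else 0)"
proof -
  consider "m < n" | "m = n" | "m > n" by linarith
  then show ?thesis
  proof cases
    case 1
    then have "green (n - 1) m + green (n + 1) m - a n * green n m
        = (u (n - 1) + u (n + 1) - a n * u n) * w m / W"
      by (simp add: green_def algebra_simps add_divide_distrib diff_divide_distrib)
    then show ?thesis using 1 by (simp add: u_rec)
  next
    case 2
    then have "green (n - 1) m + green (n + 1) m - a n * green n m
        = (u n * w (n - 1) + u (n + 1) * w n - a n * u n * w n) / W"
      by (simp add: green_def algebra_simps add_divide_distrib diff_divide_distrib)
    also have "u n * w (n - 1) + u (n + 1) * w n - a n * u n * w n = W"
      unfolding W_eq[of n, symmetric] w_rec[of n] by (simp add: algebra_simps)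
    finally show ?thesis using 2 W_nonzero by simp
  next
    case 3
    \<comment> \<open>For m = n + 1 the value at n + 1 comes from the other branch of
      \<open>green\<close>; the two branches agree on the diagonal.\<close>
    then have "green (n - 1) m + green (n + 1) m - a n * green n m
        = u m * (w (n - 1) + w (n + 1) - a n * w n) / W"
      by (cases "m = n + 1")
        (simp_all add: green_def algebra_simps add_divide_distrib diff_divide_distrib)
    then show ?thesis using 3 by (simp add: w_rec)
  qed
qed

lemma jacobi_in_l2:
  assumes "\<psi> \<in> l2"
  shows "jacobi \<psi> \<in> l2"
proof -
  have "(\<lambda>n. \<psi> (n + (- 1)) + \<psi> (n + 1) + (- a n) * \<psi> n) \<in> l2"
    using assms a_bounded by (intro l2_add l2_translate l2_mult_bounded[where B = B]) auto
  then show ?thesis by (simp add: jacobi_def[abs_def])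
qed

text \<open>The Wronskian of f with \<open>u\<close> is constant and tends to 0 at +\<infinity>,
  that with \<open>w\<close> tends to 0 at -\<infinity>. Both therefore vanish, and f is zero
  because \<open>u\<close> and \<open>w\<close> are independent.\<close>

lemma bounded_solution_zero:
  assumes rec: "\<And>n. f (n + 1) = a n * f n - f (n - 1)" and bound: "\<And>n. norm (f n) \<le> D"
  shows "f n = 0"
proof -
  have zero: "c = 0" if le: "\<And>i::nat. norm c \<le> R * exp (- \<kappa>) ^ i" for c :: complex and R
  proof -
    have "(\<lambda>i. R * exp (- \<kappa>) ^ i) \<longlonglongrightarrow> R * 0"
      using \<kappa>_pos by (intro tendsto_mult tendsto_const LIMSEQ_power_zero) auto
    then have "norm c \<le> R * 0"
      using le by (intro LIMSEQ_le_const) auto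
    then show ?thesis by simp
  qed
  have D: "D \<ge> 0" using norm_ge_zero[of "f 0"] bound[of 0] by linarith
  \<comment> \<open>The Wronskian involves two neighbouring sites, hence the factor 1 + exp
    \<kappa>. It is exact for \<open>w\<close> at -\<infinity> and generous for \<open>u\<close> at
    +\<infinity>, so one constant serves both ends.\<close>
  define R where "R = D * (C * (1 + exp \<kappa>))"
  have est: "norm (f (j + 1) * g j - f j * g (j + 1)) \<le> D * (norm (g j) + norm (g (j + 1)))"
    for j and g :: "int \<Rightarrow> complex"
  proof -
    have "norm (f (j + 1) * g j - f j * g (j + 1)) \<le> norm (f (j + 1)) * norm (g j) + norm (f j) * norm (g (j + 1))"
      using norm_triangle_ineq4[of "f (j + 1) * g j" "f j * g (j + 1)"] by (simp add: norm_mult)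
    also have "\<dots> \<le> D * norm (g j) + D * norm (g (j + 1))"
      by (intro add_mono mult_right_mono bound) auto
    finally show ?thesis by (simp add: algebra_simps)
  qed
  have "f 1 * u 0 - f 0 * u 1 = 0"
  proof (rule zero)
    fix i :: nat
    have "norm (f 1 * u 0 - f 0 * u 1) \<le> D * (norm (u (int i)) + norm (u (int i + 1)))"
      using est[of "int i" u] wronskian_const[OF rec u_rec, of "int i"] by simp
    also have "\<dots> \<le> D * (C * exp (- \<kappa> * real_of_int (int i)) + C * exp (- \<kappa> * real_of_int (int i + 1)))"
      by (intro mult_left_mono add_mono u_bound D)
    also have "\<dots> \<le> R * exp (- \<kappa>) ^ i"
    proof -
      have "exp (- \<kappa> * real_of_int (int i)) = exp (- \<kappa>) ^ i"
        by (simp flip: exp_of_nat_mult)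
      moreover have "exp (- \<kappa> * real_of_int (int i + 1)) \<le> exp \<kappa> * exp (- \<kappa>) ^ i"
        using \<kappa>_pos by (simp add: algebra_simps flip: exp_of_nat_mult exp_add)
      ultimately have "exp (- \<kappa> * real_of_int (int i)) + exp (- \<kappa> * real_of_int (int i + 1))
          \<le> (1 + exp \<kappa>) * exp (- \<kappa>) ^ i"
        by (simp add: algebra_simps)
      from mult_left_mono[OF this mult_nonneg_nonneg[OF D C_nonneg]]
      show ?thesis by (simp add: R_def algebra_simps)
    qed
    finally show "norm (f 1 * u 0 - f 0 * u 1) \<le> R * exp (- \<kappa>) ^ i" .
  qed
  moreover have "f 1 * w 0 - f 0 * w 1 = 0"
  proof (rule zero)
    fix i :: nat
    have "norm (f 1 * w 0 - f 0 * w 1) \<le> D * (norm (w (- int i)) + norm (w (- int i + 1)))"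
      using est[of "- int i" w] wronskian_const[OF rec w_rec, of "- int i"] by simp
    also have "\<dots> \<le> D * (C * exp (\<kappa> * real_of_int (- int i)) + C * exp (\<kappa> * real_of_int (- int i + 1)))"
      by (intro mult_left_mono add_mono w_bound D)
    also have "\<dots> = R * exp (- \<kappa>) ^ i"
    proof -
      have "exp (\<kappa> * real_of_int (- int i)) = exp (- \<kappa>) ^ i"
        by (simp flip: exp_of_nat_mult)
      moreover have "exp (\<kappa> * real_of_int (- int i + 1)) = exp \<kappa> * exp (- \<kappa>) ^ i"
        by (simp add: algebra_simps flip: exp_of_nat_mult exp_add)
      ultimately show ?thesis by (simp add: R_def algebra_simps)
    qed
    finally show "norm (f 1 * w 0 - f 0 * w 1) \<le> R * exp (- \<kappa>) ^ i" .
  qed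
  ultimately have "f (n + 1) * u n - f n * u (n + 1) = 0" "f (n + 1) * w n - f n * w (n + 1) = 0"
    using wronskian_const[OF rec u_rec, of n] wronskian_const[OF rec w_rec, of n] by auto
  then have "f n * (u (n + 1) * w n - u n * w (n + 1)) = 0"
    by algebra
  then show ?thesis using W_eq[of n] W_nonzero by simp
qed

lemma jacobi_inj:
  assumes "\<phi> \<in> l2" "\<psi> \<in> l2" and eq: "\<And>n. jacobi \<phi> n = jacobi \<psi> n"
  shows "\<phi> = \<psi>"
proof
  fix n
  have "(\<lambda>n. \<phi> n - \<psi> n) n = 0"
  proof (rule bounded_solution_zero)
    show "\<phi> (n + 1) - \<psi> (n + 1) = a n * (\<phi> n - \<psi> n) - (\<phi> (n - 1) - \<psi> (n - 1))" for n
      using eq[of n] unfolding jacobi_def by (simp add: algebra_simps)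
    show "norm (\<phi> n - \<psi> n) \<le> l2_norm \<phi> + l2_norm \<psi>" for n
      using norm_triangle_ineq4[of "\<phi> n" "\<psi> n"]
        norm_le_l2_norm[OF assms(1), of n] norm_le_l2_norm[OF assms(2), of n] by linarith
  qed
  then show "\<phi> n = \<psi> n" by simp
qed

lemma jacobi_boundedly_invertible:
  "bij_betw jacobi l2 l2 \<and> (\<exists>D. \<forall>\<psi>\<in>l2. l2_norm \<psi> \<le> D * l2_norm (jacobi \<psi>))"
proof -
  obtain A where A: "A \<ge> 0"
    "\<And>F m. finite F \<Longrightarrow> (\<Sum>n\<in>F. exp (- \<kappa> * \<bar>real_of_int (n - m)\<bar>)) \<le> A"
    using sum_exp_abs_int_bounded[OF \<kappa>_pos] by blast
  define D where "D = C\<^sup>2 / norm W * A"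
  have col: "(\<Sum>n\<in>F. norm (green n m)) \<le> D" if "finite F" for m F
  proof -
    have "(\<Sum>n\<in>F. norm (green n m)) \<le> (\<Sum>n\<in>F. C\<^sup>2 / norm W * exp (- \<kappa> * \<bar>real_of_int (n - m)\<bar>))"
      by (intro sum_mono norm_green_le)
    also have "\<dots> \<le> D"
      unfolding sum_distrib_left[symmetric] D_def by (intro mult_left_mono A that) auto
    finally show ?thesis .
  qed
  \<comment> \<open>Symmetry turns the column bound into the row bound.\<close>
  have sym: "green n m = green m n" for n m
    by (auto simp: green_def)
  have row: "(\<Sum>m\<in>F. norm (green n m)) \<le> D" if "finite F" for n F
    using col[OF that, of n] by (simp add: sym[of n])
  define G where "G = (\<lambda>f n. \<Sum>\<^sub>\<infinity>m. green n m * f m)"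
  have G_l2: "G f \<in> l2" and G_le: "l2_norm (G f) \<le> D * l2_norm f"
    and G_has_sum: "((\<lambda>m. green n m * f m) has_sum G f n) UNIV" if "f \<in> l2" for f n
    unfolding G_def using Schur_test_l2[of green D f, OF row col that] by auto
  have jacobi_G: "jacobi (G f) = f" if f: "f \<in> l2" for f
  proof
    fix n
    have "((\<lambda>m. (green (n - 1) m * f m + green (n + 1) m * f m) + (- a n) * (green n m * f m))
        has_sum (G f (n - 1) + G f (n + 1)) + (- a n) * G f n) UNIV"
      by (intro has_sum_add has_sum_cmult_right G_has_sum f)
    moreover have "(green (n - 1) m * f m + green (n + 1) m * f m) + (- a n) * (green n m * f m)
        = (if m = n then f m else 0)" for m
      using green_equation[of n m] by (simp add: algebra_simps flip: distrib_left split: if_splits)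
    ultimately have "((\<lambda>m. if m = n then f m else 0) has_sum jacobi (G f) n) UNIV"
      by (simp add: jacobi_def)
    moreover have "((\<lambda>m. if m = n then f m else 0) has_sum f n) UNIV"
      by (rule has_sum_finite_neutralI[of "{n}"]) auto
    ultimately show "jacobi (G f) n = f n"
      by (rule has_sum_unique)
  qed
  \<comment> \<open>\<open>G (jacobi \<psi>)\<close> and \<psi> lie in l2 and have the same image
    under \<open>jacobi\<close>, so the left inverse follows from injectivity and the right
    inverse.\<close>
  have G_jacobi: "G (jacobi \<psi>) = \<psi>" if "\<psi> \<in> l2" for \<psi>
    using that by (intro jacobi_inj G_l2 jacobi_in_l2) (auto simp: jacobi_G jacobi_in_l2)
  have "bij_betw jacobi l2 l2"
    by (rule bij_betw_byWitness[where f' = G])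
      (auto simp: G_jacobi jacobi_G G_l2 jacobi_in_l2)
  moreover have "l2_norm \<psi> \<le> D * l2_norm (jacobi \<psi>)" if "\<psi> \<in> l2" for \<psi>
    using G_le[OF jacobi_in_l2[OF that]] G_jacobi[OF that] by simp
  ultimately show ?thesis by blast
qed

end

subsection \<open>Floquet theory\<close>

lemma periodic_int_mult:
  fixes g :: "int \<Rightarrow> 'a"
  assumes "\<And>n. g (n + K) = g n"
  shows "g (n + j * K) = g n"
  using int_shift_invariant_const[of "\<lambda>j. g (n + j * K)" j] assms
  by (simp add: distrib_right add.assoc[symmetric])

lemma periodic_int_bounded:
  fixes g :: "int \<Rightarrow> real"
  assumes "K > 0" and per: "\<And>n. g (n + K) = g n"
  obtains B where "\<And>n. g n \<le> B"
proof -
  have "g n \<le> Max (g ` {0..<K})" for n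
  proof -
    have "g n = g (n mod K + n div K * K)" by simp
    also have "\<dots> = g (n mod K)" by (rule periodic_int_mult[of g K, OF per])
    finally have "g n \<in> g ` {0..<K}" using assms(1) by auto
    then show ?thesis by (intro Max_ge) auto
  qed
  then show ?thesis by (rule that)
qed

text \<open>The row vector (u(n), u(n-1)) evolves by right multiplication with transfer matrices, so
  a row eigenvector of the monodromy is initial data at \<open>n0\<close> of a solution that each
  period multiplies by \<nu>.\<close>

lemma floquet_solution:
  fixes v :: "int \<Rightarrow> real"
  assumes K: "K > 0" and per: "\<And>n. v (n + int K) = v n" and \<nu>: "\<nu> \<noteq> 0"
    and F: "F = transfer_word E (map (\<lambda>i. v (n0 + int i)) [0..<K])"
    and eig1: "p * m11 F + q * m21 F = \<nu> * p" and eig2: "p * m12 F + q * m22 F = \<nu> * q"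
  obtains u :: "int \<Rightarrow> real" where "\<And>n. u (n + 1) = (E - v n) * u n - u (n - 1)"
    "\<And>n. u (n + int K) = \<nu> * u n" "u n0 = p" "u (n0 - 1) = q"
proof -
  define P where "P = (\<lambda>i. transfer_word E (map (\<lambda>j. v (n0 + int j)) [0..<i]))"
  define x where "x = (\<lambda>i. p * m11 (P i) + q * m21 (P i))"
  define y where "y = (\<lambda>i. p * m12 (P i) + q * m22 (P i))"
  have x_Suc: "x (Suc i) = (E - v (n0 + int i)) * x i - y i" and y_Suc: "y (Suc i) = x i" for i
    by (simp_all add: x_def y_def P_def transfer_mat_def algebra_simps)
  have xy0: "x 0 = p" "y 0 = q" by (simp_all add: x_def y_def P_def)
  have xyK: "x (i + K) = \<nu> * x i \<and> y (i + K) = \<nu> * y i" for i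
  proof (induction i)
    case 0
    have "P K = F" by (simp add: P_def F)
    then show ?case using eig1 eig2 by (simp add: xy0) (simp add: x_def y_def)
  next
    case (Suc i)
    have "v (n0 + int (i + K)) = v (n0 + int i)"
      using per[of "n0 + int i"] by (simp add: algebra_simps)
    then show ?case using Suc by (simp add: x_Suc y_Suc algebra_simps)
  qed
  have xmult: "x (i + j * K) = \<nu> ^ j * x i" for i j
  proof (induction j)
    case (Suc j)
    then show ?case using xyK[of "i + j * K"] by (simp add: algebra_simps)
  qed simp
  \<comment> \<open>The iteration gives x only to the right of \<open>n0\<close>; integer powers of
    \<nu> extend it to all of Z.\<close>
  define u where "u = (\<lambda>n. \<nu> powi ((n - n0) div int K) * x (nat ((n - n0) mod int K)))"
  have u_K: "u (n + int K) = \<nu> * u n" for n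
  proof -
    have eq: "n + int K - n0 = (n - n0) + int K" by simp
    have "(n + int K - n0) div int K = (n - n0) div int K + 1"
      "(n + int K - n0) mod int K = (n - n0) mod int K"
      unfolding eq using K by (subst div_add_self2 mod_add_self2, auto)+
    then show ?thesis using \<nu> by (simp add: u_def power_int_add)
  qed
  have u_mult: "u (n + int j * int K) = \<nu> ^ j * u n" for n j
  proof (induction j)
    case (Suc j)
    then show ?case using u_K[of "n + int j * int K"] by (simp add: algebra_simps)
  qed simp
  have u_nat: "u (n0 + int i) = x i" for i
  proof -
    have "u (n0 + int i) = \<nu> ^ (i div K) * x (i mod K)"
      by (simp add: u_def power_int_def nat_mod_distrib flip: zdiv_int zmod_int)
    also have "\<dots> = x (i mod K + i div K * K)" by (simp only: xmult)
    finally show ?thesis by simp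
  qed
  have rec_nat: "u (n0 + int (Suc i) + 1) = (E - v (n0 + int (Suc i))) * u (n0 + int (Suc i)) - u (n0 + int (Suc i) - 1)" for i
  proof -
    have "n0 + int (Suc i) + 1 = n0 + int (Suc (Suc i))" "n0 + int (Suc i) - 1 = n0 + int i" by simp_all
    then show ?thesis by (simp only: u_nat x_Suc y_Suc)
  qed
  have "u (n + 1) = (E - v n) * u n - u (n - 1)" for n
  proof -
    \<comment> \<open>Enough periods to move n to the right of \<open>n0\<close>, where the
      recursion is known; the factor \<nu>^j is cancelled at the end.\<close>
    define j where "j = nat (n0 + 1 - n)"
    define i where "i = nat (n + int j * int K - n0 - 1)"
    have "int j \<le> int j * int K" using mult_left_mono[of 1 "int K" "int j"] K by simp
    moreover have "int j \<ge> n0 + 1 - n" by (simp add: j_def)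
    ultimately have "n + int j * int K - n0 - 1 \<ge> 0" by linarith
    then have i: "n0 + int (Suc i) = n + int j * int K" by (simp add: i_def)
    have shift: "n + int j * int K + 1 = (n + 1) + int j * int K"
      "n + int j * int K - 1 = (n - 1) + int j * int K" by simp_all
    have "v (n + int j * int K) = v n"
      by (rule periodic_int_mult[of v, OF per])
    then have "\<nu> ^ j * u (n + 1) = \<nu> ^ j * ((E - v n) * u n - u (n - 1))"
      using rec_nat[of i] unfolding i shift u_mult by (simp add: algebra_simps)
    then show ?thesis using \<nu> by simp
  qed
  moreover have "u n0 = p" using u_nat[of 0] by (simp add: xy0)
  moreover have "u (n0 - 1) = q"
  proof -
    \<comment> \<open>The site \<open>n0 - 1\<close> lies before the iteration starts, so its value
      is read off one period later.\<close>
    have "\<nu> * u (n0 - 1) = u (n0 + int (K - 1))"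
      using u_K[of "n0 - 1"] K by (simp add: of_nat_diff algebra_simps)
    also have "\<dots> = y (Suc (K - 1))" by (simp only: u_nat y_Suc)
    also have "\<dots> = \<nu> * q" using xyK[of 0] K by (simp add: xy0)
    finally show ?thesis using \<nu> by simp
  qed
  ultimately show ?thesis using u_K by (intro that)
qed

text \<open>The roots of X^2 - \<tau> X + 1 are real and distinct as \<tau>^2 > 4, and reciprocal,
  so one of them has modulus below 1; the names are exchanged if necessary.\<close>

lemma hyperbolic_eigenvalues:
  fixes \<tau> :: real
  assumes "\<bar>\<tau>\<bar> > 2"
  obtains \<nu> \<mu> where "\<nu> * \<mu> = 1" "\<nu> + \<mu> = \<tau>" "\<bar>\<nu>\<bar> < 1"
proof -
  define s where "s = sqrt (\<tau>\<^sup>2 - 4)"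
  have "\<tau>\<^sup>2 > 4" using power_strict_mono[OF assms, of 2] by simp
  then have s: "s\<^sup>2 = \<tau>\<^sup>2 - 4" "s > 0" by (simp_all add: s_def)
  define \<nu> \<mu> where "\<nu> = (\<tau> - s) / 2" and "\<mu> = (\<tau> + s) / 2"
  have prod: "\<nu> * \<mu> = 1"
    using s(1) by (simp add: \<nu>_def \<mu>_def field_simps power2_eq_square)
  have sum: "\<nu> + \<mu> = \<tau>" by (simp add: \<nu>_def \<mu>_def field_simps)
  have "\<bar>\<nu>\<bar> \<noteq> 1"
  proof
    assume "\<bar>\<nu>\<bar> = 1"
    then have "\<nu> = \<mu>" using prod by (cases "\<nu> \<ge> 0") (auto simp: abs_if)
    then show False using s(2) by (simp add: \<nu>_def \<mu>_def)
  qed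
  moreover have "\<bar>\<nu>\<bar> * \<bar>\<mu>\<bar> = 1" using prod by (simp flip: abs_mult)
  ultimately have "\<bar>\<nu>\<bar> < 1 \<or> \<bar>\<mu>\<bar> < 1"
    using mult_strict_right_mono[of 1 "\<bar>\<nu>\<bar>" "\<bar>\<mu>\<bar>"] by fastforce
  then show ?thesis using that[of \<nu> \<mu>] that[of \<mu> \<nu>] prod sum by (auto simp: mult.commute add.commute)
qed

text \<open>Each column of F - \<nu> suggests a solution of one equation, and the characteristic
  polynomial supplies the other. If both candidates vanish, F is \<nu> times the identity and every
  vector will do.\<close>

lemma mat2_row_eigenvector:
  assumes det: "mat2_det F = 1" and tr: "mat2_trace F = \<nu> + \<mu>" and prod: "\<nu> * \<mu> = 1"
  obtains p q where "(p, q) \<noteq> (0, 0)" "p * m11 F + q * m21 F = \<nu> * p"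
    "p * m12 F + q * m22 F = \<nu> * q"
proof (cases "m21 F = 0 \<and> m11 F = \<nu>")
  case False
  have "m21 F * m12 F + (\<nu> - m11 F) * m22 F = \<nu> * (\<nu> - m11 F)"
    using det tr prod unfolding mat2_det_def mat2_trace_def by algebra
  then show ?thesis using False
    by (intro that[of "m21 F" "\<nu> - m11 F"]) (auto simp: algebra_simps)
next
  case True
  show ?thesis
  proof (cases "m22 F = \<nu> \<and> m12 F = 0")
    case False
    then show ?thesis using True
      by (intro that[of "\<nu> - m22 F" "m12 F"]) (auto simp: algebra_simps)
  next
    case True': True
    then show ?thesis using True by (intro that[of 1 0]) auto
  qed
qed

lemma row_eigenvectors_independent:
  fixes p q r s :: real
  assumes "(p, q) \<noteq> (0, 0)" "(r, s) \<noteq> (0, 0)" "\<nu> \<noteq> \<mu>"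
    and 1: "p * m11 F + q * m21 F = \<nu> * p" and 2: "p * m12 F + q * m22 F = \<nu> * q"
    and 3: "r * m11 F + s * m21 F = \<mu> * r" and 4: "r * m12 F + s * m22 F = \<mu> * s"
  shows "p * s - q * r \<noteq> 0"
proof
  assume 0: "p * s - q * r = 0"
  have "(\<nu> - \<mu>) * (p * r) = 0" using 0 1 3 by algebra
  moreover have "(\<nu> - \<mu>) * (q * s) = 0" using 0 2 4 by algebra
  moreover have "(\<nu> - \<mu>) * (p * s) = 0" using 0 1 3 2 4 by algebra
  ultimately show False using assms(1-3) 0 by auto
qed

text \<open>|u(n)| exp (- c n) is K-periodic, hence bounded. Only |\<nu>| enters, so negative
  multipliers, that is traces below -2, are covered.\<close>

lemma floquet_bound:
  fixes u :: "int \<Rightarrow> real"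
  assumes K: "K > 0" and per: "\<And>n. u (n + int K) = \<nu> * u n" and \<nu>: "\<bar>\<nu>\<bar> = exp (c * real K)"
  obtains C where "\<And>n. \<bar>u n\<bar> \<le> C * exp (c * real_of_int n)"
proof -
  have "\<bar>u (n + int K)\<bar> * exp (- c * real_of_int (n + int K)) = \<bar>u n\<bar> * exp (- c * real_of_int n)" for n
    by (simp add: per \<nu> abs_mult exp_add algebra_simps flip: exp_minus)
      (simp flip: exp_add mult.assoc)
  then obtain C where C: "\<And>n. \<bar>u n\<bar> * exp (- c * real_of_int n) \<le> C"
    using periodic_int_bounded[of "int K" "\<lambda>n. \<bar>u n\<bar> * exp (- c * real_of_int n)"] K by auto
  have "\<bar>u n\<bar> \<le> C * exp (c * real_of_int n)" for n
    using mult_right_mono[OF C[of n], of "exp (c * real_of_int n)"] by (simp add: mult.assoc flip: exp_add)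
  then show ?thesis by (rule that)
qed

lemma not_in_spectrum_of_hyperbolic_monodromy:
  assumes K: "K > 0" and per: "\<And>n. flatten k y (n + int K) = flatten k y n"
    and hyp: "\<bar>mat2_trace (transfer_word E (map (\<lambda>i. flatten k y (n0 + int i)) [0..<K]))\<bar> > 2"
  shows "complex_of_real E \<notin> l2_spectrum (schroedinger k y)"
proof -
  define v where "v = flatten k y"
  have per: "v (n + int K) = v n" for n using per by (simp add: v_def)
  define F where "F = transfer_word E (map (\<lambda>i. v (n0 + int i)) [0..<K])"
  have det: "mat2_det F = 1" by (simp add: F_def)
  obtain \<nu> \<mu> where lm: "\<nu> * \<mu> = 1" "\<nu> + \<mu> = mat2_trace F" "\<bar>\<nu>\<bar> < 1"
    using hyperbolic_eigenvalues hyp unfolding F_def v_def by blast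
  have "\<nu>\<^sup>2 < 1" using lm(3) by (simp add: abs_square_less_1)
  then have nz: "\<nu> \<noteq> 0" "\<mu> \<noteq> 0" "\<nu> \<noteq> \<mu>"
    using lm(1) by (auto simp: power2_eq_square)
  obtain p q where pq: "(p, q) \<noteq> (0, 0)" "p * m11 F + q * m21 F = \<nu> * p"
    "p * m12 F + q * m22 F = \<nu> * q"
    using mat2_row_eigenvector[OF det lm(2)[symmetric] lm(1)] by blast
  obtain r s where rs: "(r, s) \<noteq> (0, 0)" "r * m11 F + s * m21 F = \<mu> * r"
    "r * m12 F + s * m22 F = \<mu> * s"
    using mat2_row_eigenvector[OF det, of \<mu> \<nu>] lm by (auto simp: mult.commute add.commute)
  obtain u where u: "\<And>n. u (n + 1) = (E - v n) * u n - u (n - 1)"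
    "\<And>n. u (n + int K) = \<nu> * u n" "u n0 = p" "u (n0 - 1) = q"
    using floquet_solution[OF K per nz(1) F_def pq(2,3)] by blast
  obtain w where w: "\<And>n. w (n + 1) = (E - v n) * w n - w (n - 1)"
    "\<And>n. w (n + int K) = \<mu> * w n" "w n0 = r" "w (n0 - 1) = s"
    using floquet_solution[OF K per nz(2) F_def rs(2,3)] by blast
  \<comment> \<open>The Lyapunov exponent, determined by |\<nu>| = exp (- \<kappa> K).\<close>
  define \<kappa> where "\<kappa> = - ln \<bar>\<nu>\<bar> / real K"
  have \<kappa>: "\<kappa> > 0" using lm(3) nz K by (simp add: \<kappa>_def divide_neg_pos)
  have e1: "\<bar>\<nu>\<bar> = exp (- \<kappa> * real K)" using K nz by (simp add: \<kappa>_def)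
  have "\<mu> = inverse \<nu>" using lm(1) nz by (simp add: field_simps)
  then have e2: "\<bar>\<mu>\<bar> = exp (\<kappa> * real K)" using e1 by (simp add: abs_inverse exp_minus)
  obtain C1 where C1: "\<And>n. \<bar>u n\<bar> \<le> C1 * exp (- \<kappa> * real_of_int n)"
    using floquet_bound[of K u, OF K u(2) e1] by blast
  obtain C2 where C2: "\<And>n. \<bar>w n\<bar> \<le> C2 * exp (\<kappa> * real_of_int n)"
    using floquet_bound[of K w, OF K w(2) e2] by blast
  obtain B where B: "\<And>n. \<bar>E - v n\<bar> \<le> B"
    using periodic_int_bounded[of "int K" "\<lambda>n. \<bar>E - v n\<bar>"] K per by auto
  define C where "C = max C1 C2"
  \<comment> \<open>The constant Wronskian is evaluated at \<open>n0 - 1\<close>, where the initial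
    data are the two eigenvectors.\<close>
  have "u 1 * w 0 - u 0 * w 1 = p * s - q * r"
    using wronskian_const[of u "\<lambda>n. E - v n" w "n0 - 1", OF u(1) w(1)] u(3,4) w(3,4) by simp
  also have "\<dots> \<noteq> 0"
    by (rule row_eigenvectors_independent[OF pq(1) rs(1) nz(3) pq(2,3) rs(2,3)])
  finally have W: "u 1 * w 0 - u 0 * w 1 \<noteq> 0" .
  interpret exponential_dichotomy "\<lambda>n. complex_of_real (E - v n)" "\<lambda>n. complex_of_real (u n)"
    "\<lambda>n. complex_of_real (w n)" \<kappa> C B
  proof
    fix n
    show "norm (complex_of_real (E - v n)) \<le> B" using B by (simp flip: of_real_diff)
    show "complex_of_real (u (n + 1)) = complex_of_real (E - v n) * complex_of_real (u n) - complex_of_real (u (n - 1))"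
      unfolding u(1) by simp
    show "complex_of_real (w (n + 1)) = complex_of_real (E - v n) * complex_of_real (w n) - complex_of_real (w (n - 1))"
      unfolding w(1) by simp
    have "C1 * exp (- \<kappa> * real_of_int n) \<le> C * exp (- \<kappa> * real_of_int n)"
      "C2 * exp (\<kappa> * real_of_int n) \<le> C * exp (\<kappa> * real_of_int n)"
      by (simp_all add: C_def)
    then show "norm (complex_of_real (u n)) \<le> C * exp (- \<kappa> * real_of_int n)"
      and "norm (complex_of_real (w n)) \<le> C * exp (\<kappa> * real_of_int n)"
      unfolding norm_of_real using C1[of n] C2[of n] by linarith+
  qed (use \<kappa> W in \<open>auto simp flip: of_real_mult of_real_diff\<close>)
  have "jacobi = (\<lambda>\<psi> n. schroedinger k y \<psi> n - complex_of_real E * \<psi> n)"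
    by (intro ext, unfold jacobi_def schroedinger_def) (simp add: v_def algebra_simps)
  then show ?thesis
    using jacobi_boundedly_invertible by (simp add: l2_spectrum_def)
qed

subsection \<open>Perturbation of words\<close>

definition letter :: "nat \<Rightarrow> (nat \<Rightarrow> real) \<Rightarrow> real list" where
  "letter k y = map y [0..<k]"

lemma concat_letters_eq_map_upt:
  "concat (map (letter k) ys) = map (\<lambda>i. (ys ! (i div k)) (i mod k)) [0..<length ys * k]"
proof (cases "k = 0")
  case True
  then show ?thesis by (auto simp: letter_def)
next
  case False
  show ?thesis
  proof (induction ys)
    case (Cons y ys)
    have "[0..<length (y # ys) * k] = [0..<k] @ map (\<lambda>i. i + k) [0..<length ys * k]"
      using upt_add_eq_append[of 0 k "length ys * k"] by (simp add: map_add_upt add.commute)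
    then have "map (\<lambda>i. ((y # ys) ! (i div k)) (i mod k)) [0..<length (y # ys) * k]
        = map (\<lambda>i. ((y # ys) ! (i div k)) (i mod k)) [0..<k]
          @ map (\<lambda>i. (ys ! (i div k)) (i mod k)) [0..<length ys * k]"
      using False by simp
    also have "map (\<lambda>i. ((y # ys) ! (i div k)) (i mod k)) [0..<k] = letter k y"
      by (simp add: letter_def)
    finally show ?case using Cons by simp
  qed simp
qed

lemma not_in_spectrum_of_hyperbolic_word:
  assumes k: "k > 0" and ys: "ys \<noteq> []"
    and hyp: "\<bar>mat2_trace (transfer_word E (concat (map (letter k) ys)))\<bar> > 2"
  shows "complex_of_real E \<notin> l2_spectrum (schroedinger k (periodic_ext ys))"
proof (rule not_in_spectrum_of_hyperbolic_monodromy)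
  show "0 < length ys * k" using k ys by simp
  show "flatten k (periodic_ext ys) (n + int (length ys * k)) = flatten k (periodic_ext ys) n" for n
  proof -
    have eq: "n + int (length ys * k) - 1 = (n - 1) + int (length ys) * int k" by simp
    have "(n + int (length ys * k) - 1) div int k = (n - 1) div int k + int (length ys)"
      "(n + int (length ys * k) - 1) mod int k = (n - 1) mod int k"
      unfolding eq using k by simp_all
    moreover have "periodic_ext ys (j + int (length ys)) = periodic_ext ys j" for j
    proof -
      have "j + int (length ys) - 1 = (j - 1) + int (length ys)" by simp
      then show ?thesis unfolding periodic_ext_def by (metis mod_add_self2)
    qed
    ultimately show ?thesis by (simp add: flatten_def)
  qed
  \<comment> \<open>The period is read from site k + 1: letter number 1 of the periodic extension
    occupies the sites k + 1 to 2k, and it is entry 0 of the list.\<close>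
  have "flatten k (periodic_ext ys) (int k + 1 + int i) = (ys ! (i div k)) (i mod k)"
    if "i < length ys * k" for i
  proof -
    have eq: "int k + 1 + int i - 1 = int i + int k" by simp
    have "(int k + 1 + int i - 1) div int k = int (i div k) + 1"
      "(int k + 1 + int i - 1) mod int k = int (i mod k)"
      unfolding eq using k by (simp_all add: zdiv_int zmod_int)
    moreover have "i div k < length ys" using that by (simp add: less_mult_imp_div_less)
    ultimately show ?thesis
      by (simp add: flatten_def periodic_ext_def)
  qed
  then have "map (\<lambda>i. flatten k (periodic_ext ys) (int k + 1 + int i)) [0..<length ys * k]
      = concat (map (letter k) ys)"
    unfolding concat_letters_eq_map_upt by simp
  then show "2 < \<bar>mat2_trace (transfer_word E
      (map (\<lambda>i. flatten k (periodic_ext ys) (int k + 1 + int i)) [0..<length ys * k]))\<bar>"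
    using hyp by simp
qed

definition near :: "real \<Rightarrow> real list \<Rightarrow> real list \<Rightarrow> bool" where
  "near \<delta> = list_all2 (\<lambda>x x'. \<bar>x' - x\<bar> < \<delta>)"

lemma near_simps [simp]:
  "near \<delta> (x # xs) (x' # xs') \<longleftrightarrow> \<bar>x' - x\<bar> < \<delta> \<and> near \<delta> xs xs'"
  by (simp add: near_def)

text \<open>Free blocks alternate with \<open>bs\<close>, which also stands at both ends. Working
  from the right, each new free block lies between \<open>bs\<close> and the finished tail, both
  with nonzero upper left entry.\<close>

lemma perturb_m11_words:
  assumes bs: "m11 (transfer_word E bs) \<noteq> 0" and \<delta>: "\<delta> > 0" and "\<forall>zs\<in>set zss. zs \<noteq> []"
  obtains zss' where "list_all2 (near \<delta>) zss zss'"
    "m11 (transfer_word E (bs @ concat (map (\<lambda>zs. zs @ bs) zss'))) \<noteq> 0"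
  using assms(3)
proof (induction zss arbitrary: thesis)
  case Nil
  then show ?case using bs by simp
next
  case (Cons zs zss)
  obtain zss' where zss': "list_all2 (near \<delta>) zss zss'"
    "m11 (transfer_word E (bs @ concat (map (\<lambda>zs. zs @ bs) zss'))) \<noteq> 0"
    using Cons.IH Cons.prems(2) by auto
  obtain zs' where "near \<delta> zs zs'"
    "m11 (transfer_word E bs *
      (transfer_word E zs' * transfer_word E (bs @ concat (map (\<lambda>zs. zs @ bs) zss')))) \<noteq> 0"
    unfolding near_def
    using perturb_m11_mult_transfer_word[OF bs zss'(2) \<delta>, of zs] Cons.prems(2) by auto
  then show ?case using zss' by (intro Cons.prems(1)[of "zs' # zss'"]) (auto simp: mult.assoc)
qed

text \<open>The very first free entry is reserved as the parameter t; all later ones are fixed once,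
  to make the upper left entry of the remaining product R nonzero.\<close>

lemma hyperbolic_word_perturbation:
  assumes bs: "m11 (transfer_word E bs) \<noteq> 0" and \<delta>: "\<delta> > 0"
    and zss: "zss \<noteq> []" "\<forall>zs\<in>set zss. zs \<noteq> []"
  obtains wss where "wss \<noteq> []" "\<forall>ws\<in>set wss. list_all2 (near \<delta>) zss ws"
    "\<bar>mat2_trace (transfer_word E (concat (map (\<lambda>zs. zs @ bs) (concat wss))))\<bar> > 2"
proof -
  obtain t0 zs rest where zss_eq: "zss = (t0 # zs) # rest"
    using zss by (metis list.exhaust list.set_intros(1))
  obtain rest' where rest': "list_all2 (near \<delta>) rest rest'"
    "m11 (transfer_word E (bs @ concat (map (\<lambda>zs. zs @ bs) rest'))) \<noteq> 0"
    using perturb_m11_words[OF bs \<delta>, of rest] zss(2) zss_eq by auto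
  \<comment> \<open>\<open>zs\<close> is empty when the first letter has a single free entry; this
    is harmless, since the factor on its right already has a nonzero upper left entry.\<close>
  obtain zs' where zs': "near \<delta> zs zs'"
    "m11 (transfer_word E zs' * transfer_word E (bs @ concat (map (\<lambda>zs. zs @ bs) rest'))) \<noteq> 0"
    unfolding near_def using perturb_m11_transfer_word[OF rest'(2) \<delta>] by blast
  define R where "R = transfer_word E zs' * transfer_word E (bs @ concat (map (\<lambda>zs. zs @ bs) rest'))"
  have "mat2_det R = 1" "m11 R \<noteq> 0" using zs'(2) by (simp_all add: R_def)
  then obtain ts where ts: "ts \<noteq> []" "\<forall>t\<in>set ts. \<bar>t - t0\<bar> < \<delta>"
    "\<bar>mat2_trace (prod_list (map (\<lambda>t. transfer_mat E t * R) ts))\<bar> > 2"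
    using hyperbolic_perturbation \<delta> by blast
  \<comment> \<open>All copies of the word share \<open>zs'\<close> and \<open>rest'\<close> and
    differ only in their first entry.\<close>
  define wss where "wss = map (\<lambda>t. (t # zs') # rest') ts"
  have "transfer_word E (concat (map (\<lambda>zs. zs @ bs) (concat wss)))
      = prod_list (map (\<lambda>t. transfer_mat E t * R) ts)"
    unfolding wss_def by (induction ts) (simp_all add: R_def mult.assoc)
  then show ?thesis
    using ts zs'(1) rest'(1) by (intro that[of wss]) (auto simp: wss_def zss_eq)
qed

section \<open>Distances between words\<close>

lemma norm_on_Rvec_le:
  assumes N: "norm_on_Rvec k N" and z: "z \<in> Rvec k" and \<delta>: "\<And>i. i < k \<Longrightarrow> \<bar>z i\<bar> \<le> \<delta>"
  shows "N z \<le> \<delta> * (\<Sum>i<k. N (\<lambda>j. of_bool (j = i)))"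
proof -
  have unit: "(\<lambda>j. of_bool (j = i)) \<in> Rvec k" if "i < k" for i
    using that by (auto simp: topspace_Euclidean_space)
  \<comment> \<open>Coordinates are switched on one at a time, each costing one triangle
    inequality.\<close>
  have "N (\<lambda>j. if j < l then z j else 0) \<le> \<delta> * (\<Sum>i<l. N (\<lambda>j. of_bool (j = i)))" if "l \<le> k" for l
    using that
  proof (induction l)
    case 0
    have "(\<lambda>i. 0) \<in> Rvec k" by (simp add: topspace_Euclidean_space)
    then have "N (\<lambda>i. 0) = 0" using N unfolding norm_on_Rvec_def by blast
    then show ?case by simp
  next
    case (Suc l)
    have mem: "(\<lambda>j. if j < l then z j else 0) \<in> Rvec k" "(\<lambda>j. z l * of_bool (j = l)) \<in> Rvec k"
      using Suc.prems by (auto simp: topspace_Euclidean_space)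
    have "(\<lambda>j. if j < Suc l then z j else 0) = (\<lambda>j. (if j < l then z j else 0) + z l * of_bool (j = l))"
      by (auto simp: less_Suc_eq)
    then have "N (\<lambda>j. if j < Suc l then z j else 0)
        \<le> N (\<lambda>j. if j < l then z j else 0) + N (\<lambda>j. z l * of_bool (j = l))"
      using N mem unfolding norm_on_Rvec_def by simp
    also have "N (\<lambda>j. z l * of_bool (j = l)) = \<bar>z l\<bar> * N (\<lambda>j. of_bool (j = l))"
      using N unit[of l] Suc.prems unfolding norm_on_Rvec_def by auto
    also have "\<dots> \<le> \<delta> * N (\<lambda>j. of_bool (j = l))"
      using N unit[of l] Suc.prems unfolding norm_on_Rvec_def by (intro mult_right_mono \<delta>) auto
    finally show ?case using Suc by (simp add: algebra_simps)
  qed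
  moreover have "(\<lambda>j. if j < k then z j else 0) = z"
    using z by (auto simp: topspace_Euclidean_space)
  ultimately show ?thesis by (metis order_refl)
qed

lemma nth_concat_periodic:
  assumes "\<forall>ws\<in>set wss. list_all2 R zs ws" "r < length (concat wss)"
  shows "R (zs ! (r mod length zs)) (concat wss ! r)"
  using assms
proof (induction wss arbitrary: r)
  case (Cons ws wss)
  have len: "length ws = length zs" using Cons.prems(1) list_all2_lengthD[of R zs ws] by simp
  show ?case
  proof (cases "r < length zs")
    case True
    then show ?thesis using Cons.prems(1) len by (simp add: nth_append list_all2_nthD)
  next
    case False
    then show ?thesis using Cons.IH[of "r - length zs"] Cons.prems len
      by (auto simp: nth_append le_mod_geq)
  qed
qed simp

text \<open>The length of the concatenation is a multiple of that of \<open>zs\<close>, so the two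
  periodic extensions stay aligned: every letter is compared with its own perturbed copy, however
  many copies there are.\<close>

lemma word_dist_le:
  assumes zs: "zs \<noteq> []" and wss: "wss \<noteq> []" "\<forall>ws\<in>set wss. list_all2 R zs ws"
    and R: "\<And>x y. R x y \<Longrightarrow> N (\<lambda>i. f x i - f y i) \<le> \<eta>"
  shows "word_dist N (map f zs) (map f (concat wss)) \<le> \<eta>"
  unfolding word_dist_def
proof (rule cSUP_least)
  fix j :: int
  define p L where "p = length zs" and "L = length (concat wss)"
  have "\<forall>ws\<in>set wss. length ws = p"
    using wss(2) list_all2_lengthD unfolding p_def by metis
  then have "L = length wss * p"
    unfolding L_def by (induction wss) auto
  then have dvd: "int p dvd int L" and L: "L > 0"
    using zs wss(1) by (auto simp: p_def)
  define r where "r = nat ((j - 1) mod int L)"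
  have r: "r < L" using L by (simp add: r_def nat_less_iff)
  \<comment> \<open>Divisibility of L by p makes reduction modulo L and then modulo p the same as
    reduction modulo p.\<close>
  have "int (r mod p) = (j - 1) mod int p"
    using L dvd by (simp add: r_def zmod_int mod_mod_cancel)
  then have rp: "r mod p = nat ((j - 1) mod int p)" by linarith
  have "r mod p < p" using zs by (simp add: p_def)
  then have "periodic_ext (map f zs) j = f (zs ! (r mod p))"
    by (simp add: periodic_ext_def rp flip: p_def)
  moreover have "periodic_ext (map f (concat wss)) j = f (concat wss ! r)"
    using r unfolding periodic_ext_def length_map L_def[symmetric] r_def[symmetric]
    by (simp add: L_def)
  ultimately show "N (\<lambda>i. periodic_ext (map f zs) j i - periodic_ext (map f (concat wss)) j i) \<le> \<eta>"
    using R[OF nth_concat_periodic[OF wss(2)]] r by (simp add: p_def L_def)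
qed simp

section \<open>Topology of the slice\<close>

lemma vconcat_slice_eq:
  assumes b: "b \<in> Rvec m"
  shows "{vconcat n x b | x. x \<in> Rvec n} = {z \<in> Rvec (n + m). \<forall>i<m. z (n + i) = b i}"
proof (intro equalityI subsetI)
  fix z assume "z \<in> {vconcat n x b | x. x \<in> Rvec n}"
  then show "z \<in> {z \<in> Rvec (n + m). \<forall>i<m. z (n + i) = b i}"
    using b by (auto simp: vconcat_def topspace_Euclidean_space)
next
  fix z assume z: "z \<in> {z \<in> Rvec (n + m). \<forall>i<m. z (n + i) = b i}"
  have "z = vconcat n (\<lambda>i. if i < n then z i else 0) b"
  proof
    fix i
    show "z i = vconcat n (\<lambda>i. if i < n then z i else 0) b i"
    proof (cases "i < n + m")
      case True
      then show ?thesis using z by (cases "i < n") (auto simp: vconcat_def dest: spec[of _ "i - n"])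
    next
      case False
      then show ?thesis using z b by (auto simp: vconcat_def topspace_Euclidean_space)
    qed
  qed
  then show "z \<in> {vconcat n x b | x. x \<in> Rvec n}"
    by (auto simp: topspace_Euclidean_space)
qed

lemma closed_no_isolated_vconcat:
  assumes n: "n \<ge> 1" and b: "b \<in> Rvec m"
  shows "closed_no_isolated (n + m) {vconcat n x b | x. x \<in> Rvec n}"
  unfolding closed_no_isolated_def
proof
  let ?Y = "{vconcat n x b | x. x \<in> Rvec n}"
  have cont: "continuous_on UNIV (\<lambda>z :: nat \<Rightarrow> real. z i)" for i
    by (rule continuous_on_product_coordinates)
  have "closed {z :: nat \<Rightarrow> real. \<forall>i<m. z (n + i) = b i}"
    by (intro closed_Collect_all closed_Collect_imp closed_Collect_eq cont continuous_on_const) auto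
  moreover have "closed (Rvec (n + m))"
    using closedin_Euclidean_imp_closed closedin_topspace by blast
  ultimately show "closedin (Euclidean_space (n + m)) ?Y"
    unfolding vconcat_slice_eq[OF b] closedin_Euclidean_space_iff by (auto simp: Collect_conj_eq)
  show "?Y \<subseteq> Euclidean_space (n + m) derived_set_of ?Y"
  proof
    fix z assume "z \<in> ?Y"
    then have z: "z \<in> Rvec (n + m)" "\<And>i. i < m \<Longrightarrow> z (n + i) = b i"
      unfolding vconcat_slice_eq[OF b] by auto
    show "z \<in> Euclidean_space (n + m) derived_set_of ?Y"
      unfolding in_derived_set_of
    proof (intro conjI allI impI z(1))
      fix T assume T: "z \<in> T \<and> openin (Euclidean_space (n + m)) T"
      then obtain U :: "(nat \<Rightarrow> real) set" where U: "open U" "T = U \<inter> Rvec (n + m)"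
        unfolding Euclidean_space_def openin_subtopology
        by (auto simp: euclidean_product_topology)
      \<comment> \<open>Coordinate 0 is free because n \<ge> 1; varying it alone stays in the slice
        and meets every neighbourhood of z in other points.\<close>
      define g :: "real \<Rightarrow> nat \<Rightarrow> real" where "g = (\<lambda>t. z(0 := t))"
      have "continuous_on UNIV (\<lambda>t. g t i)" for i
        by (cases "i = 0") (auto simp: g_def)
      then have "continuous_on UNIV g"
        by (rule continuous_on_coordinatewise_then_product)
      then have "open (g -` U)"
        using U(1) by (simp add: open_vimage)
      moreover have "z 0 \<in> g -` U" using T U by (simp add: g_def)
      ultimately obtain e where e: "e > 0" "ball (z 0) e \<subseteq> g -` U"
        using open_contains_ball by blast
      have "z 0 + e / 2 \<in> ball (z 0) e" using e(1) by (simp add: dist_real_def)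
      then have "g (z 0 + e / 2) \<in> U" using e(2) by blast
      moreover have "g (z 0 + e / 2) \<in> ?Y"
        unfolding vconcat_slice_eq[OF b] using z n by (auto simp: g_def topspace_Euclidean_space)
      moreover have "g (z 0 + e / 2) \<in> Rvec (n + m)"
        using z n by (auto simp: g_def topspace_Euclidean_space)
      moreover have "g (z 0 + e / 2) \<noteq> z"
        using e(1) by (auto simp: g_def fun_eq_iff)
      ultimately show "\<exists>y\<noteq>z. y \<in> ?Y \<and> y \<in> T" using U(2) by blast
    qed
  qed
qed

theorem theorem2p11:
  fixes m n :: nat and b :: "nat \<Rightarrow> real" and N :: "(nat \<Rightarrow> real) \<Rightarrow> real"
  assumes "m \<ge> 1" and "n \<ge> 1" and "b \<in> Rvec m" and "norm_on_Rvec (n + m) N"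
  shows "gap_rich (n + m) N {vconcat n x b | x. x \<in> Rvec n}"
proof -
  let ?Y = "{vconcat n x b | x. x \<in> Rvec n}"
  define k where "k = n + m"
  \<comment> \<open>This set depends on b alone, so it serves all words and all \<epsilon>; being
    finite, it is discrete.\<close>
  define S where "S = {E. m11 (transfer_word E (letter m b)) = 0}"
  have "discrete S"
    using finite_m11_transfer_word_zero discrete_compact_finite_iff unfolding S_def by blast
  \<comment> \<open>Builds a letter from its free coordinates. The guard makes the first argument of
    \<open>vconcat\<close> vanish from index n on, so it lies in \<open>Rvec n\<close> whatever the
    length of \<open>zs\<close>.\<close>
  define f where "f = (\<lambda>zs. vconcat n (\<lambda>i. if i < n then zs ! i else 0) b)"
  have f_Y: "f zs \<in> ?Y" for zs
    by (auto simp: f_def topspace_Euclidean_space)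
  have f_Rvec: "f zs \<in> Rvec k" for zs
    using f_Y[of zs] unfolding vconcat_slice_eq[OF assms(3)] k_def by simp
  have letter_f: "letter k (f zs) = zs @ letter m b" if "length zs = n" for zs
    using that by (intro nth_equalityI) (auto simp: letter_def f_def vconcat_def nth_append k_def)
  have f_letter: "f (letter n y) = y" if "y \<in> ?Y" for y
    using that by (auto simp: f_def vconcat_def letter_def)
  define M where "M = (\<Sum>i<k. N (\<lambda>j. of_bool (j = i)))"
  have M: "M \<ge> 0"
    using assms(4) unfolding M_def norm_on_Rvec_def k_def
    by (intro sum_nonneg) (auto simp: topspace_Euclidean_space)
  have N_near: "N (\<lambda>i. f x i - f y i) \<le> \<delta> * M" if near: "near \<delta> x y \<and> length x = n" and \<delta>: "\<delta> > 0" for x y \<delta>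
    unfolding M_def
  proof (rule norm_on_Rvec_le)
    show "norm_on_Rvec k N" using assms(4) by (simp add: k_def)
    show "(\<lambda>i. f x i - f y i) \<in> Rvec k"
      using f_Rvec[of x] f_Rvec[of y] by (simp add: topspace_Euclidean_space)
    show "\<bar>f x i - f y i\<bar> \<le> \<delta>" for i
    proof (cases "i < n")
      case True
      then have "\<bar>y ! i - x ! i\<bar> < \<delta>"
        using near unfolding near_def by (auto dest: list_all2_nthD)
      then show ?thesis using True by (simp add: f_def vconcat_def abs_minus_commute)
    qed (use \<delta> in \<open>simp add: f_def vconcat_def\<close>)
  qed
  have "\<exists>ys\<in>nonempty_words ?Y. word_dist N xs ys < \<epsilon> \<and>
      complex_of_real E \<notin> l2_spectrum (schroedinger k (periodic_ext ys))"
    if E: "E \<notin> S" and xs: "xs \<in> nonempty_words ?Y" and \<epsilon>: "\<epsilon> > 0" for E xs \<epsilon>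
  proof -
    \<comment> \<open>The 1 keeps the denominator positive when M = 0 and makes \<delta> M strictly
      smaller than \<epsilon>.\<close>
    define \<delta> where "\<delta> = \<epsilon> / (M + 1)"
    have \<delta>: "\<delta> > 0" "\<delta> * M < \<epsilon>" using \<epsilon> M by (simp_all add: \<delta>_def field_simps)
    define zss where "zss = map (letter n) xs"
    have "f (letter n x) = x" if "x \<in> set xs" for x
      by (rule f_letter) (use xs that in \<open>unfold nonempty_words_def, blast\<close>)
    then have xs_eq: "xs = map f zss"
      by (simp add: zss_def map_idI)
    have zss: "zss \<noteq> []" "\<forall>zs\<in>set zss. length zs = n"
      using xs by (auto simp: zss_def nonempty_words_def letter_def)
    \<comment> \<open>Here n \<ge> 1 enters the spectral part: every letter has a free entry to
      perturb.\<close>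
    then have "\<forall>zs\<in>set zss. zs \<noteq> []" using assms(2) by auto
    then obtain wss where wss: "wss \<noteq> []" "\<forall>ws\<in>set wss. list_all2 (near \<delta>) zss ws"
      and hyp: "\<bar>mat2_trace (transfer_word E (concat (map (\<lambda>zs. zs @ letter m b) (concat wss))))\<bar> > 2"
      using hyperbolic_word_perturbation[OF _ \<delta>(1) zss(1)] E unfolding S_def by blast
    have wss': "\<forall>ws\<in>set wss. list_all2 (\<lambda>x y. near \<delta> x y \<and> length x = n) zss ws"
      using wss(2) zss(2) by (auto simp: list_all2_conv_all_nth)
    have len: "length w = n" if w: "w \<in> set (concat wss)" for w
    proof -
      obtain ws where ws: "ws \<in> set wss" "w \<in> set ws" using w by auto
      then obtain i where "i < length ws" "w = ws ! i" by (auto simp: in_set_conv_nth)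
      then have "near \<delta> (zss ! i) w \<and> length (zss ! i) = n"
        using list_all2_nthD2[OF bspec[OF wss' ws(1)]] by blast
      then show ?thesis
        unfolding near_def using list_all2_lengthD by metis
    qed
    have ne: "concat wss \<noteq> []"
      using wss zss(1) by (cases wss) auto
    define ys where "ys = map f (concat wss)"
    have flat: "map (letter k) ys = map (\<lambda>zs. zs @ letter m b) (concat wss)"
      unfolding ys_def map_map using len by (intro map_cong) (auto simp: letter_f)
    have "complex_of_real E \<notin> l2_spectrum (schroedinger k (periodic_ext ys))"
    proof (rule not_in_spectrum_of_hyperbolic_word)
      show "k > 0" using assms(1) by (simp add: k_def)
      show "ys \<noteq> []" using ne by (simp add: ys_def)
      show "\<bar>mat2_trace (transfer_word E (concat (map (letter k) ys)))\<bar> > 2"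
        unfolding flat by (rule hyp)
    qed
    moreover have "word_dist N xs ys \<le> \<delta> * M"
      unfolding xs_eq ys_def using N_near[OF _ \<delta>(1)] by (intro word_dist_le[OF zss(1) wss(1) wss']) auto
    moreover have "ys \<in> nonempty_words ?Y"
      using f_Y ne by (auto simp: nonempty_words_def ys_def)
    ultimately show ?thesis using \<delta>(2) by force
  qed
  then have "gap_rich_with k N ?Y S"
    using \<open>discrete S\<close> closed_no_isolated_vconcat[OF assms(2,3)]
    unfolding gap_rich_with_def k_def by blast
  then show ?thesis unfolding gap_rich_def k_def by blast
qed

end
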